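(* Let $b \ge 2$ be an integer and let $\mathbf x = x_1x_2\dots$ be an infinite word over $\{0,1,\dots,b-1\}$ which is not ultimately periodic and satisfies $$\rho := \limsup_{n\to+\infty} \frac{p(n,\mathbf x)}{n} < \frac43.$$ Then $$\liminf_{n\to\infty} \frac{r(n,\mathbf x)}{n} \le 1 - \frac{4-3\rho}{2(1+2\rho)(2-\rho)}$$ and $$\mu\Big(\sum_{j\ge1} \frac{x_j}{b^j}\Big) \ge 2 + \frac{4-3\rho}{\rho(9-4\rho)}.$$
   Context: For an infinite word $\mathbf x = x_1x_2\dots$ over a finite alphabet, $p(n,\mathbf x)$ is the number of distinct factors $x_{j+1}\dots x_{j+n}$ ($j\ge 0$) of length $n$. The repetition function is $r(n,\mathbf x) = \min\{ m \ge 1 : x_{m+1}\dots x_{m+n} = x_{i+1}\dots x_{i+n} \text{ for some } 0 \le i < m\}$, equivalently the largest $m$ such that the $m$ blocks $x_1\dots x_n, x_2\dots x_{n+1},\dots,x_m\dots x_{n+m-1}$ are pairwise distinct. For an irrational real $\xi$, $\mu(\xi)$ is its irrationality exponent: the supremum of real $\mu$ such that $|\xi - p/q| < q^{-\mu}$ has infinitely many rational solutions $p/q$, $q\ge1$. *)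

theory Defs
  imports "HOL-Analysis.Analysis"
begin

text \<open>
  An infinite word \<open>x\<^sub>1x\<^sub>2\<dots>\<close> is a function \<open>x :: nat \<Rightarrow> 'a\<close>; indexing
  starts at 0, so the letter \<open>x\<^sub>j\<^sub>+\<^sub>1\<close> is \<open>x j\<close> and \<open>factor x j n\<close> is the
  block \<open>x\<^sub>j\<^sub>+\<^sub>1\<dots>x\<^sub>j\<^sub>+\<^sub>n\<close>.
\<close>

definition factor :: "(nat \<Rightarrow> 'a) \<Rightarrow> nat \<Rightarrow> nat \<Rightarrow> 'a list" where
  "factor x j n = map x [j..<j + n]"

definition ultimately_periodic :: "(nat \<Rightarrow> 'a) \<Rightarrow> bool" where
  "ultimately_periodic x \<longleftrightarrow> (\<exists>N T. T \<ge> 1 \<and> (\<forall>n\<ge>N. x (n + T) = x n))"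

text \<open>The cardinality below is the intended one only for words over a finite
  alphabet, where the set of factors of a given length is finite.\<close>

definition complexity :: "nat \<Rightarrow> (nat \<Rightarrow> 'a) \<Rightarrow> nat" where
  "complexity n x = card (range (\<lambda>j. factor x j n))"

text \<open>Over a finite alphabet the minimum exists, by the pigeonhole principle.\<close>

definition repetition :: "nat \<Rightarrow> (nat \<Rightarrow> 'a) \<Rightarrow> nat" where
  "repetition n x = (LEAST m. m \<ge> 1 \<and> (\<exists>i<m. factor x m n = factor x i n))"

text \<open>Solutions are counted as rational numbers, not as pairs of numerator and
  denominator. The supremum is taken in the extended reals, since the exponent
  may be infinite.\<close>

definition irrationality_exponent :: "real \<Rightarrow> ereal" where
  "irrationality_exponent \<xi> = (SUP \<mu>\<in>{\<mu>::real.
      infinite {s::rat. \<exists>(p::int) (q::nat). q \<ge> 1 \<and> s = of_int p / of_nat q \<and>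
                  \<bar>\<xi> - of_int p / of_nat q\<bar> < of_nat q powr (- \<mu>)}}. ereal \<mu>)"

end

theory Submission
  imports Defs
begin

text \<open>
  Suppose \<open>r(n) \<ge> (1 - d) n\<close> and \<open>p(n) \<le> (4/3 - 8d/5) n\<close> up to a constant. As \<open>p\<close> grows more
  slowly than \<open>2n\<close>, there are arbitrarily large \<open>N\<close> with \<open>p(N + 1) = p(N) + 1\<close>. At such a level
  there is exactly one right special factor \<open>R\<close>, it has two extensions, and the next occurrence
  of \<open>R\<close> is determined by the letter following the current one; so after a prefix \<open>P\<close> the word
  is a concatenation of two return words \<open>A\<close>, \<open>B\<close>, of lengths \<open>a\<close>, \<open>b\<close>. Extending \<open>R\<close> to the left
  as far as possible leaves \<open>a\<close> and \<open>b\<close> unchanged and makes \<open>R\<close> bispecial, that is, \<open>A\<close> and \<open>B\<close> end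
  with different letters. Write \<open>|P| = u + l\<close>, where \<open>l\<close> is the length of the longest common suffix
  of \<open>P\<close> with \<open>A\<close> or \<open>B\<close>. Then \<open>N < a + b \<le> p(N) + 1 - u\<close>, and whichever way the sequence of return
  words starts, it exhibits early repetitions of long factors; each gives a linear inequality in
  \<open>N, a, b, u, l\<close>. If \<open>AA\<close>, \<open>AB\<close>, \<open>BA\<close> and \<open>BB\<close> all occur, then \<open>p\<close> moreover grows with slope 2 for the
  next \<open>min a b\<close> levels. In every case the inequalities are contradictory for large \<open>N\<close>.

  A repetition \<open>x\<^sub>i\<^sub>+\<^sub>1\<dots>x\<^sub>i\<^sub>+\<^sub>n = x\<^sub>m\<^sub>+\<^sub>1\<dots>x\<^sub>m\<^sub>+\<^sub>n\<close> with \<open>i < m = r(n)\<close> yields a rational approximation with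
  denominator \<open>b\<^sup>m - b\<^sup>i\<close> and error at most \<open>b\<^sup>-\<^sup>n\<close> divided by this denominator, which turns the
  bound \<open>1 - d\<close> for \<open>liminf r(n)/n\<close> into the bound \<open>1 + 1/(1 - d)\<close> for the irrationality exponent.
\<close>

section \<open>Factors, complexity and repetitions\<close>

text \<open>Equality of factors in terms of positions: cutting, shifting and joining blocks become
  arithmetic on indices.\<close>

definition agree :: "(nat \<Rightarrow> 'a) \<Rightarrow> nat \<Rightarrow> nat \<Rightarrow> nat \<Rightarrow> bool" where
  "agree x p q n \<longleftrightarrow> (\<forall>i<n. x (p + i) = x (q + i))"

lemma factor_eq_iff_agree: "factor x p n = factor x q n \<longleftrightarrow> agree x p q n"
proof -
  have "factor x p n = factor x q n \<longleftrightarrow> (\<forall>i<n. factor x p n ! i = factor x q n ! i)"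
    by (simp add: list_eq_iff_nth_eq factor_def)
  then show ?thesis
    by (simp add: agree_def factor_def)
qed

lemma agree_refl [simp]: "agree x p p n"
  by (simp add: agree_def)

lemma agree_sym: "agree x p q n \<Longrightarrow> agree x q p n"
  by (simp add: agree_def)

lemma agree_trans: "agree x p q n \<Longrightarrow> agree x q s n \<Longrightarrow> agree x p s n"
  by (simp add: agree_def)

lemma agree_mono: "agree x p q n \<Longrightarrow> m \<le> n \<Longrightarrow> agree x p q m"
  by (simp add: agree_def)

lemma agree_nth: "agree x p q n \<Longrightarrow> i < n \<Longrightarrow> x (p + i) = x (q + i)"
  by (simp add: agree_def)

lemma agree_Suc: "agree x p q (Suc n) \<longleftrightarrow> agree x p q n \<and> x (p + n) = x (q + n)"
  by (auto simp: agree_def less_Suc_eq)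

lemma agree_Suc_left: "agree x p q (Suc n) \<longleftrightarrow> x p = x q \<and> agree x (Suc p) (Suc q) n"
  by (auto simp: agree_def All_less_Suc2)

lemma agree_add: "agree x p q (m + n) \<longleftrightarrow> agree x p q m \<and> agree x (p + m) (q + m) n"
proof safe
  show "agree x (p + m) (q + m) n" if "agree x p q (m + n)"
    using that by (simp add: agree_def add.assoc)
  show "agree x p q (m + n)" if "agree x p q m" "agree x (p + m) (q + m) n"
    unfolding agree_def
  proof (intro allI impI)
    fix i assume "i < m + n"
    show "x (p + i) = x (q + i)"
    proof (cases "i < m")
      case True
      then show ?thesis using that by (simp add: agree_def)
    next
      case False
      then have "x (p + m + (i - m)) = x (q + m + (i - m))"
        using that \<open>i < m + n\<close> by (intro agree_nth[of x "p + m" "q + m" n]) auto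
      then show ?thesis using False by simp
    qed
  qed
qed (auto elim: agree_mono)

lemma agree_shift: "agree x p q n \<Longrightarrow> k \<le> n \<Longrightarrow> agree x (p + k) (q + k) (n - k)"
  using agree_add[of x p q k "n - k"] by simp

lemma repetition_le:
  assumes "agree x p q n" "p < q"
  shows "repetition n x \<le> q"
  unfolding repetition_def
  using assms by (intro Least_le) (auto simp: factor_eq_iff_agree intro: agree_sym)

lemma take_factor: "m \<le> n \<Longrightarrow> take m (factor x p n) = factor x p m"
  by (simp add: factor_def take_map)

lemma finite_factors:
  assumes "finite (range x)"
  shows "finite (range (\<lambda>p. factor x p n))"
proof (rule finite_subset)
  show "range (\<lambda>p. factor x p n) \<subseteq> {w. set w \<subseteq> range x \<and> length w = n}"
    by (auto simp: factor_def)
qed (use assms in \<open>simp add: finite_lists_length_eq\<close>)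

text \<open>Pigeonhole gives equal blocks at two positions beyond \<open>M\<close>; determinism
  carries the agreement to the right for ever, so their distance is a period.\<close>

lemma ultimately_periodic_if_deterministic:
  assumes "finite (range x)"
    and det: "\<And>p q. M \<le> p \<Longrightarrow> M \<le> q \<Longrightarrow> agree x p q n \<Longrightarrow> x (p + n) = x (q + n)"
  shows "ultimately_periodic x"
proof -
  have "finite ((\<lambda>p. factor x p n) ` {M..})"
    by (rule finite_subset[OF _ finite_factors[OF assms(1), of n]]) auto
  then have "\<not> inj_on (\<lambda>p. factor x p n) {M..}"
    using finite_imageD infinite_Ici by blast
  then obtain p' q' where "M \<le> p'" "M \<le> q'" "p' \<noteq> q'" "agree x p' q' n"
    by (auto simp: inj_on_def factor_eq_iff_agree)
  then obtain p q where pq: "M \<le> p" "p < q" "agree x p q n"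
    by (metis agree_sym linorder_neqE_nat)
  have *: "agree x (p + i) (q + i) n" for i
  proof (induction i)
    case (Suc i)
    then have "agree x (p + i) (q + i) (Suc n)"
      using det[of "p + i" "q + i"] pq by (simp add: agree_Suc)
    then show ?case by (simp add: agree_Suc_left)
  qed (use pq in simp)
  have "x (m + (q - p)) = x m" if "m \<ge> p + n" for m
  proof -
    have "x (p + (m - p - n) + n) = x (q + (m - p - n) + n)"
      using det[OF _ _ *[of "m - p - n"]] pq by simp
    moreover have "q + (m - p - n) + n = m + (q - p)" "p + (m - p - n) + n = m"
      using that pq by auto
    ultimately show ?thesis by simp
  qed
  then show ?thesis
    unfolding ultimately_periodic_def using pq(2) by (intro exI[of _ "p + n"] exI[of _ "q - p"]) auto
qed

text \<open>Choose for every factor of length \<open>n\<close> an extension outside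
  \<open>E\<close>. The extensions differ, having different prefixes, and \<open>E\<close> is
  surplus.\<close>

lemma complexity_Suc_ge:
  assumes fin: "finite (range x)" and "finite E"
    and E: "E \<subseteq> range (\<lambda>p. factor x p (Suc n))"
    and rep: "\<And>p. \<exists>q. agree x p q n \<and> factor x q (Suc n) \<notin> E"
  shows "complexity n x + card E \<le> complexity (Suc n) x"
proof -
  have "\<exists>q. factor x q n = w \<and> factor x q (Suc n) \<notin> E" if "w \<in> range (\<lambda>p. factor x p n)" for w
    using that rep by (auto simp: factor_eq_iff_agree) (meson agree_sym)
  then obtain g where g: "\<And>w. w \<in> range (\<lambda>p. factor x p n) \<Longrightarrow>
      factor x (g w) n = w \<and> factor x (g w) (Suc n) \<notin> E"
    by metis
  let ?h = "\<lambda>w. factor x (g w) (Suc n)"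
  have inj: "inj_on ?h (range (\<lambda>p. factor x p n))"
  proof (rule inj_onI)
    fix v w assume vw: "v \<in> range (\<lambda>p. factor x p n)" "w \<in> range (\<lambda>p. factor x p n)" "?h v = ?h w"
    then have "take n (?h v) = take n (?h w)" by simp
    then show "v = w" using g vw(1,2) by (simp add: take_factor)
  qed
  have "complexity n x + card E = card (?h ` range (\<lambda>p. factor x p n)) + card E"
    using inj by (simp add: complexity_def card_image)
  also have "\<dots> = card (?h ` range (\<lambda>p. factor x p n) \<union> E)"
    using g \<open>finite E\<close> fin by (intro card_Un_disjoint[symmetric]) (auto simp: finite_factors)
  also have "\<dots> \<le> complexity (Suc n) x"
    unfolding complexity_def using E by (intro card_mono finite_factors[OF fin]) auto
  finally show ?thesis .
qed

lemma complexity_Suc_ge1: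
  assumes fin: "finite (range x)" and p: "agree x p p' n" "x (p + n) \<noteq> x (p' + n)"
  shows "complexity n x + 1 \<le> complexity (Suc n) x"
proof -
  have "\<exists>q. agree x s q n \<and> factor x q (Suc n) \<notin> {factor x p' (Suc n)}" for s
  proof (cases "agree x s p' (Suc n)")
    case True
    then show ?thesis using p
      by (intro exI[of _ p]) (auto simp: factor_eq_iff_agree agree_Suc intro: agree_sym agree_trans)
  next
    case False
    then show ?thesis by (intro exI[of _ s]) (auto simp: factor_eq_iff_agree)
  qed
  then show ?thesis
    using complexity_Suc_ge[OF fin, of "{factor x p' (Suc n)}" n] by auto
qed

text \<open>\<open>pq\<close> covers two situations: two different right special factors, or one
  with three extensions.\<close>

lemma complexity_Suc_ge2:
  assumes fin: "finite (range x)"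
    and p: "agree x p p' n" "x (p + n) \<noteq> x (p' + n)"
    and q: "agree x q q' n" "x (q + n) \<noteq> x (q' + n)"
    and pq: "\<not> agree x p q n \<or> p = q \<and> x (p' + n) \<noteq> x (q' + n)"
  shows "complexity n x + 2 \<le> complexity (Suc n) x"
proof -
  let ?E = "{factor x p' (Suc n), factor x q' (Suc n)}"
  have "\<not> agree x p' q' (Suc n)"
    using p q pq by (auto simp: agree_Suc intro: agree_sym agree_trans)
  then have card: "card ?E = 2" by (simp add: factor_eq_iff_agree)
  have "\<exists>t. agree x s t n \<and> factor x t (Suc n) \<notin> ?E" for s
  proof -
    consider "agree x s p' n" | "agree x s q' n" "\<not> agree x s p' n"
      | "\<not> agree x s p' n" "\<not> agree x s q' n" by blast
    then show ?thesis
    proof cases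
      case 1
      have "\<not> agree x p p' (Suc n)" using p by (simp add: agree_Suc)
      moreover have "\<not> agree x p q' (Suc n)"
        using pq q by (auto simp: agree_Suc intro: agree_sym agree_trans)
      ultimately show ?thesis using 1 p
        by (intro exI[of _ p]) (auto simp: factor_eq_iff_agree intro: agree_sym agree_trans)
    next
      case 2
      have "\<not> agree x q q' (Suc n)" using q by (simp add: agree_Suc)
      moreover have "\<not> agree x q p' (Suc n)"
        using pq p by (auto simp: agree_Suc intro: agree_sym agree_trans)
      ultimately show ?thesis using 2 q
        by (intro exI[of _ q]) (auto simp: factor_eq_iff_agree intro: agree_sym agree_trans)
    next
      case 3
      then show ?thesis
        by (intro exI[of _ s]) (auto simp: factor_eq_iff_agree agree_Suc)
    qed
  qed
  then show ?thesis
    using complexity_Suc_ge[OF fin, of ?E n] card by auto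
qed

lemma complexity_Suc_gt:
  assumes "finite (range x)" "\<not> ultimately_periodic x"
  shows "complexity n x + 1 \<le> complexity (Suc n) x"
proof -
  obtain p q where "agree x p q n" "x (p + n) \<noteq> x (q + n)"
    using ultimately_periodic_if_deterministic[OF assms(1), of 0 n] assms(2) by blast
  then show ?thesis by (rule complexity_Suc_ge1[OF assms(1)])
qed

lemma complexity_ge:
  assumes "finite (range x)" "\<not> ultimately_periodic x"
  shows "complexity n x \<ge> n + 1"
proof (induction n)
  case 0
  have "range (\<lambda>p. factor x p 0) = {[]}" by (auto simp: factor_def)
  then show ?case by (simp add: complexity_def)
next
  case (Suc n)
  then show ?case using complexity_Suc_gt[OF assms, of n] by linarith
qed

lemma ex_agree_repetition:
  assumes "finite (range x)"
  shows "\<exists>i<repetition n x. agree x i (repetition n x) n"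
proof -
  have "\<not> inj (\<lambda>p. factor x p n)"
    using finite_factors[OF assms, of n] finite_imageD infinite_UNIV_nat by blast
  then obtain p q where "p < q" "agree x p q n"
    by (auto simp: inj_on_def factor_eq_iff_agree) (metis agree_sym linorder_neqE_nat)
  then have "\<exists>m. m \<ge> 1 \<and> (\<exists>i<m. factor x m n = factor x i n)"
    by (intro exI[of _ q]) (auto simp: factor_eq_iff_agree intro: agree_sym)
  from LeastI_ex[OF this, folded repetition_def]
  show ?thesis
    by (auto simp: factor_eq_iff_agree intro: agree_sym)
qed

section \<open>Levels with a single right special factor\<close>

text \<open>
  The right special factor \<open>R\<close> of length \<open>N\<close> is given by one of its positions \<open>r\<close>; \<open>a\<close> and \<open>b\<close> are the
  times of return to \<open>R\<close> after the letters \<open>\<alpha>\<close> and \<open>\<beta>\<close>.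
\<close>

locale special_level =
  fixes x :: "nat \<Rightarrow> 'a" and N r :: nat and \<alpha> \<beta> :: 'a and a b :: nat
  assumes letters: "agree x r p N \<Longrightarrow> x (p + N) = \<alpha> \<or> x (p + N) = \<beta>"
    and distinct: "\<alpha> \<noteq> \<beta>"
    and det: "agree x p q N \<Longrightarrow> \<not> agree x r p N \<Longrightarrow> x (p + N) = x (q + N)"
    and inf_\<alpha>: "\<exists>p\<ge>M. agree x r p N \<and> x (p + N) = \<alpha>"
    and inf_\<beta>: "\<exists>p\<ge>M. agree x r p N \<and> x (p + N) = \<beta>"
    and return_pos: "a \<ge> 1" "b \<ge> 1"
    and return_\<alpha>: "agree x r p N \<Longrightarrow> x (p + N) = \<alpha> \<Longrightarrow> agree x r (p + a) N"
    and return_\<beta>: "agree x r p N \<Longrightarrow> x (p + N) = \<beta> \<Longrightarrow> agree x r (p + b) N"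
    and first_\<alpha>: "agree x r p N \<Longrightarrow> x (p + N) = \<alpha> \<Longrightarrow> 0 < i \<Longrightarrow> i < a \<Longrightarrow> \<not> agree x r (p + i) N"
    and first_\<beta>: "agree x r p N \<Longrightarrow> x (p + N) = \<beta> \<Longrightarrow> 0 < i \<Longrightarrow> i < b \<Longrightarrow> \<not> agree x r (p + i) N"
begin

definition occ :: "nat \<Rightarrow> bool" where "occ p \<longleftrightarrow> agree x r p N"

lemma occ_agree: "occ p \<Longrightarrow> occ q \<Longrightarrow> agree x p q N"
  unfolding occ_def by (blast intro: agree_sym agree_trans)

lemma occ_cong: "agree x p q N \<Longrightarrow> occ p \<longleftrightarrow> occ q"
  unfolding occ_def by (blast intro: agree_sym agree_trans)

text \<open>R is the only right special factor, so the next letter is forced as long as the window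
  of length \<open>N\<close> is not an occurrence of R.\<close>

lemma agree_extend:
  assumes "agree x p q N" "\<And>j. j < d \<Longrightarrow> \<not> occ (p + j)"
  shows "agree x p q (N + d)"
  using assms(2)
proof (induction d)
  case (Suc d)
  then have *: "agree x p q (N + d)" by simp
  then have "agree x (p + d) (q + d) N"
    using agree_shift[of x p q "N + d" d] by simp
  then have "x (p + d + N) = x (q + d + N)"
    using det[of "p + d" "q + d"] Suc.prems[of d] by (simp add: occ_def)
  then show ?case using * by (simp add: agree_Suc ac_simps)
qed (use assms in simp)

lemma agree_\<alpha>:
  assumes "occ p" "occ q" "x (p + N) = \<alpha>" "x (q + N) = \<alpha>"
  shows "agree x p q (a + N)"
proof -
  have "agree x p q (Suc N)" using occ_agree[of p q] assms by (simp add: agree_Suc)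
  then have "agree x (Suc p) (Suc q) N" "x p = x q" by (simp_all add: agree_Suc_left)
  moreover have "\<not> occ (Suc p + j)" if "j < a - 1" for j
    using first_\<alpha>[of p "Suc j"] assms that by (simp add: occ_def)
  ultimately have "agree x (Suc p) (Suc q) (N + (a - 1))" by (intro agree_extend) auto
  then show ?thesis
    using \<open>x p = x q\<close> return_pos(1) agree_Suc_left[of x p q "N + (a - 1)"] by (simp add: add.commute)
qed

lemma swap: "special_level x N r \<beta> \<alpha> b a"
  by unfold_locales
    (use letters distinct det inf_\<alpha> inf_\<beta> return_pos return_\<alpha> return_\<beta> first_\<alpha> first_\<beta> in blast)+

lemma agree_\<beta>:
  assumes "occ p" "occ q" "x (p + N) = \<beta>" "x (q + N) = \<beta>"
  shows "agree x p q (b + N)"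
  using special_level.agree_\<alpha>[OF swap, of p q] assms
  by (simp add: occ_def special_level.occ_def[OF swap])

lemma occ_\<alpha>: "occ p \<Longrightarrow> x (p + N) = \<alpha> \<Longrightarrow> occ (p + a)"
  and occ_\<beta>: "occ p \<Longrightarrow> x (p + N) = \<beta> \<Longrightarrow> occ (p + b)"
  using return_\<alpha> return_\<beta> by (auto simp: occ_def)

text \<open>
  A Fine and Wilf argument: \<open>R\<close> has the periods \<open>a\<close> and \<open>b\<close>, so \<open>a + b \<le> N\<close> would equate the letters
  \<open>\<alpha>\<close> and \<open>\<beta>\<close> that follow \<open>R\<close>.
\<close>

lemma return_gt: "N < a + b"
proof (rule ccontr)
  assume "\<not> N < a + b"
  then have le: "a + b \<le> N" by simp
  obtain p where p: "occ p" "x (p + N) = \<alpha>" using inf_\<alpha> by (auto simp: occ_def)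
  obtain q where q: "occ q" "x (q + N) = \<beta>" using inf_\<beta> by (auto simp: occ_def)
  have a: "x (p + a + i) = x (p + i)" and b: "x (q + b + i) = x (q + i)"
    and pq: "x (p + i) = x (q + i)" if "i < N" for i
    using agree_nth[OF occ_agree that] p q occ_\<alpha> occ_\<beta> by blast+
  \<comment> \<open>The letter after R sits at offset \<open>N - a\<close> of the next R. The
    offsets then pass through \<open>N - a - b\<close> and \<open>N - b\<close> inside copies of R
    and end at the letter after the other R.\<close>
  have "x (p + N) = x (p + a + (N - a))" using le by simp
  also have "\<dots> = x (q + b + (N - a - b))" using a[of "N - a"] pq[of "N - a"] return_pos le by simp
  also have "\<dots> = x (p + a + (N - a - b))"
    using a[of "N - a - b"] b[of "N - a - b"] pq[of "N - a - b"] return_pos le by simp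
  also have "\<dots> = x (p + (N - b))" using le by simp
  also have "\<dots> = x (q + b + (N - b))" using b[of "N - b"] pq[of "N - b"] return_pos le by simp
  also have "\<dots> = x (q + N)" using le by simp
  finally show False using p q distinct by simp
qed

text \<open>This is |P|, where P is the prefix before the return words.\<close>

definition first :: nat where "first = (LEAST p. occ p)"

lemma occ_first: "occ first"
  unfolding first_def by (rule LeastI[of _ r]) (simp add: occ_def)

lemma first_le: "occ p \<Longrightarrow> first \<le> p"
  unfolding first_def by (rule Least_le)

lemma occ_pred:
  assumes "occ t" "t \<noteq> first"
  shows "(\<exists>p. occ p \<and> x (p + N) = \<alpha> \<and> t = p + a) \<or> (\<exists>p. occ p \<and> x (p + N) = \<beta> \<and> t = p + b)"
proof -
  define p where "p = Max {p. occ p \<and> p < t}"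
  have "first \<in> {p. occ p \<and> p < t}" using occ_first first_le[of t] assms by auto
  then have "p \<in> {p. occ p \<and> p < t}" unfolding p_def by (intro Max_in) auto
  then have p: "occ p" "p < t" by auto
  have max: "\<not> occ q" if "p < q" "q < t" for q
  proof
    assume "occ q"
    then have "q \<le> p" unfolding p_def using that by (intro Max_ge) auto
    then show False using that by simp
  qed
  have gap: "t = p + d" if "occ (p + d)" "d \<ge> 1" "\<And>i. 0 < i \<Longrightarrow> i < d \<Longrightarrow> \<not> occ (p + i)" for d
  proof -
    have "\<not> p + d < t" using max[of "p + d"] that by auto
    moreover have "\<not> t < p + d"
    proof
      assume "t < p + d"
      then have "t - p < d" using p by simp
      then show False using that(3)[of "t - p"] p assms(1) by simp
    qed
    ultimately show ?thesis by simp
  qed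
  show ?thesis
  proof (cases "x (p + N) = \<alpha>")
    case True
    then have "t = p + a"
      using p occ_\<alpha>[of p] return_pos first_\<alpha>[of p] by (intro gap) (auto simp: occ_def)
    then show ?thesis using True p by blast
  next
    case False
    then have \<beta>: "x (p + N) = \<beta>" using letters p by (auto simp: occ_def)
    then have "t = p + b"
      using p occ_\<beta>[of p] return_pos first_\<beta>[of p] by (intro gap) (auto simp: occ_def)
    then show ?thesis using \<beta> p by blast
  qed
qed

text \<open>
  The exception for the first occurrence is essential: the prefix of the word need not recur, so
  the letter before \<open>first\<close> may differ from the one before all later occurrences.
\<close>

lemma special_level_Suc:
  assumes c: "\<And>t. occ t \<Longrightarrow> t \<noteq> first \<Longrightarrow> x (t - 1) = c"
  shows "\<exists>r'. special_level x (Suc N) r' \<alpha> \<beta> a b"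
proof -
  obtain r'' where "r'' \<ge> Suc first" "occ r''" using inf_\<alpha> by (auto simp: occ_def)
  then obtain r' where r': "occ (Suc r')" "Suc r' > first" by (cases r'') auto
  then have xr': "x r' = c" using c[of "Suc r'"] by simp
  have occ': "agree x r' p (Suc N) \<longleftrightarrow> occ (Suc p) \<and> x p = c" for p
    using r' xr' occ_agree[of "Suc r'" "Suc p"] occ_cong[of "Suc r'" "Suc p"]
    by (auto simp: agree_Suc_left)
  have late: "x (t + k) = c" if "occ (Suc t)" "k \<ge> 1" "occ (Suc t + k)" for t k
    using c[of "Suc t + k"] first_le[OF that(1)] that by simp
  have "special_level x (Suc N) r' \<alpha> \<beta> a b"
  proof
    show "x (p + Suc N) = \<alpha> \<or> x (p + Suc N) = \<beta>" if "agree x r' p (Suc N)" for p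
      using letters[of "Suc p"] that by (simp add: occ' occ_def)
    show "x (p + Suc N) = x (q + Suc N)" if "agree x p q (Suc N)" "\<not> agree x r' p (Suc N)" for p q
    proof (cases "occ (Suc p)")
      case True
      \<comment> \<open>The block at \<open>p\<close> is R preceded by a letter other than
        \<open>c\<close>; it can occur only just before \<open>first\<close>, which forces
        \<open>p = q\<close>.\<close>
      then have "x p \<noteq> c" using that(2) by (simp add: occ')
      moreover have "x p = x q" "agree x (Suc p) (Suc q) N"
        using that(1) by (simp_all add: agree_Suc_left)
      ultimately have "x p \<noteq> c" "x q \<noteq> c" "occ (Suc q)"
        using True occ_cong[of "Suc p" "Suc q"] by auto
      then have "Suc p = first" "Suc q = first" using c[of "Suc p"] c[of "Suc q"] True by auto
      then have "p = q" by (metis Suc_inject)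
      then show ?thesis by simp
    next
      case False
      then show ?thesis using det[of "Suc p" "Suc q"] that by (auto simp: agree_Suc_left occ_def)
    qed
    show "\<exists>p\<ge>M. agree x r' p (Suc N) \<and> x (p + Suc N) = \<alpha>" for M
    proof -
      obtain p where "p \<ge> M + first + 2" "occ p" "x (p + N) = \<alpha>" using inf_\<alpha> by (auto simp: occ_def)
      then show ?thesis using c[of p] by (intro exI[of _ "p - 1"]) (auto simp: occ')
    qed
    show "\<exists>p\<ge>M. agree x r' p (Suc N) \<and> x (p + Suc N) = \<beta>" for M
    proof -
      obtain p where "p \<ge> M + first + 2" "occ p" "x (p + N) = \<beta>" using inf_\<beta> by (auto simp: occ_def)
      then show ?thesis using c[of p] by (intro exI[of _ "p - 1"]) (auto simp: occ')
    qed
    show "agree x r' (p + a) (Suc N)" if "agree x r' p (Suc N)" "x (p + Suc N) = \<alpha>" for p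
      using occ_\<alpha>[of "Suc p"] late[of p a] return_pos that by (simp add: occ')
    show "agree x r' (p + b) (Suc N)" if "agree x r' p (Suc N)" "x (p + Suc N) = \<beta>" for p
      using occ_\<beta>[of "Suc p"] late[of p b] return_pos that by (simp add: occ')
    show "\<not> agree x r' (p + i) (Suc N)"
      if "agree x r' p (Suc N)" "x (p + Suc N) = \<alpha>" "0 < i" "i < a" for p i
      using first_\<alpha>[of "Suc p" i] that by (simp add: occ' occ_def)
    show "\<not> agree x r' (p + i) (Suc N)"
      if "agree x r' p (Suc N)" "x (p + Suc N) = \<beta>" "0 < i" "i < b" for p i
      using first_\<beta>[of "Suc p" i] that by (simp add: occ' occ_def)
  qed (use distinct return_pos in auto)
  then show ?thesis by blast
qed

text \<open>Every occurrence of R but the first is preceded by A or B, so a common last letter of A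
  and B precedes them all.\<close>

lemma special_level_Suc':
  assumes "occ s" "x (s + N) = \<alpha>" "occ t" "x (t + N) = \<beta>" "x (s + a - 1) = x (t + b - 1)"
  shows "\<exists>r'. special_level x (Suc N) r' \<alpha> \<beta> a b"
proof (rule special_level_Suc)
  fix p assume p: "occ p" "p \<noteq> first"
  show "x (p - 1) = x (s + a - 1)"
  proof (rule disjE[OF occ_pred[OF p]])
    assume "\<exists>q. occ q \<and> x (q + N) = \<alpha> \<and> p = q + a"
    then obtain q where q: "occ q" "x (q + N) = \<alpha>" "p = q + a" by blast
    then have "x (q + (a - 1)) = x (s + (a - 1))"
      using agree_nth[OF agree_\<alpha>[of q s], of "a - 1"] assms return_pos by simp
    then show ?thesis using q return_pos by simp
  next
    assume "\<exists>q. occ q \<and> x (q + N) = \<beta> \<and> p = q + b"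
    then obtain q where q: "occ q" "x (q + N) = \<beta>" "p = q + b" by blast
    then have "x (q + (b - 1)) = x (t + (b - 1))"
      using agree_nth[OF agree_\<beta>[of q t], of "b - 1"] assms return_pos by simp
    then show ?thesis using q return_pos assms by simp
  qed
qed

end

text \<open>All \<alpha>-returns read the same word, and so do all \<beta>-returns; a failure for
  one pair \<open>s\<close>, \<open>t\<close> is what \<open>special_level_Suc'\<close> asks
  for.\<close>

locale bispecial_level = special_level +
  assumes left_special: "occ s \<Longrightarrow> x (s + N) = \<alpha> \<Longrightarrow> occ t \<Longrightarrow> x (t + N) = \<beta>
    \<Longrightarrow> x (s + a - 1) \<noteq> x (t + b - 1)"

text \<open>Extending R to the left keeps \<open>a\<close> and \<open>b\<close>, while
  \<open>return_gt\<close> bounds the level by \<open>a + b\<close>; so the extension stops, and it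
  can only stop at a bispecial level.\<close>

lemma ex_bispecial_level:
  assumes "special_level x n r \<alpha> \<beta> a b"
  shows "\<exists>N\<ge>n. \<exists>r. bispecial_level x N r \<alpha> \<beta> a b"
proof (rule ccontr)
  assume none: "\<not> ?thesis"
  have "\<exists>r. special_level x (n + k) r \<alpha> \<beta> a b" for k
  proof (induction k)
    case (Suc k)
    then obtain r where r: "special_level x (n + k) r \<alpha> \<beta> a b" by blast
    interpret special_level x "n + k" r \<alpha> \<beta> a b by (rule r)
    have "\<not> bispecial_level x (n + k) r \<alpha> \<beta> a b" using none le_add1[of n k] by blast
    then show ?case
      using special_level_Suc' r by (auto simp: bispecial_level_def bispecial_level_axioms_def)
  qed (use assms in auto)
  then obtain r where r: "special_level x (n + (a + b)) r \<alpha> \<beta> a b" by blast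
  show False using special_level.return_gt[OF r] by simp
qed

text \<open>By \<open>complexity_Suc_ge2\<close>, growth by one leaves no second right special
  factor and no third extension.\<close>

lemma ex_special_level:
  assumes fin: "finite (range x)" and np: "\<not> ultimately_periodic x"
    and compl: "complexity (Suc n) x \<le> complexity n x + 1"
  shows "\<exists>r \<alpha> \<beta> a b. special_level x n r \<alpha> \<beta> a b"
proof -
  obtain r r' where r: "agree x r r' n" "x (r + n) \<noteq> x (r' + n)"
    using ultimately_periodic_if_deterministic[OF fin, of 0 n] np by blast
  define \<alpha> where "\<alpha> = x (r + n)"
  define \<beta> where "\<beta> = x (r' + n)"
  let ?O = "\<lambda>p. agree x r p n"
  have letters: "x (p + n) = \<alpha> \<or> x (p + n) = \<beta>" if "?O p" for p
    using complexity_Suc_ge2[OF fin r, of r p] compl that unfolding \<alpha>_def \<beta>_def by fastforce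
  have det: "x (p + n) = x (q + n)" if "agree x p q n" "\<not> ?O p" for p q
    using complexity_Suc_ge2[OF fin r, of p q] compl that by fastforce
  \<comment> \<open>If one letter ceased to follow R from \<open>M\<close> on, the next letter would
    be determined there and the word ultimately periodic.\<close>
  have inf: "\<exists>p\<ge>M. ?O p \<and> x (p + n) = c" if "c = \<alpha> \<or> c = \<beta>" for M c
  proof (rule ccontr)
    assume none: "\<not> ?thesis"
    have "x (p + n) = x (q + n)" if "M \<le> p" "M \<le> q" "agree x p q n" for p q
    proof (cases "?O p")
      case True
      then have "?O q" using that agree_trans by blast
      then show ?thesis using True that letters[of p] letters[of q] none \<open>c = \<alpha> \<or> c = \<beta>\<close> by metis
    qed (use det that in blast)
    then show False using ultimately_periodic_if_deterministic[OF fin] np by blast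
  qed
  define gap where "gap = (\<lambda>p. LEAST d. d \<ge> 1 \<and> ?O (p + d))"
  have ex: "\<exists>d\<ge>1. ?O (p + d)" for p
  proof -
    obtain q where "q \<ge> p + 1" "?O q" using inf[of \<alpha>] by blast
    then show ?thesis by (intro exI[of _ "q - p"]) auto
  qed
  have gap: "gap p \<ge> 1" "?O (p + gap p)" for p
    using LeastI_ex[OF ex[of p]] unfolding gap_def by auto
  have gap_least: "\<not> ?O (p + i)" if "0 < i" "i < gap p" for p i
    using not_less_Least[of i "\<lambda>d. d \<ge> 1 \<and> ?O (p + d)"] that unfolding gap_def by auto
  \<comment> \<open>After equal letters the texts agree up to the next R after \<open>p\<close>, so
    R also occurs at that distance after \<open>q\<close>.\<close>
  have gap_le: "gap q \<le> gap p" if "?O p" "?O q" "x (p + n) = x (q + n)" for p q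
  proof -
    have pq: "agree x p q (Suc n)"
      using that by (auto simp: agree_Suc intro: agree_sym agree_trans)
    have "agree x (p + Suc d) (q + Suc d) n" if "d < gap p" for d
      using that
    proof (induction d)
      case 0
      then show ?case using pq by (simp add: agree_Suc_left)
    next
      case (Suc d)
      then have "agree x (p + Suc d) (q + Suc d) n" by simp
      moreover have "\<not> ?O (p + Suc d)" using gap_least[of "Suc d" p] Suc.prems by simp
      ultimately have "agree x (p + Suc d) (q + Suc d) (Suc n)"
        using det[of "p + Suc d" "q + Suc d"] by (simp add: agree_Suc)
      then show ?case by (simp add: agree_Suc_left)
    qed
    from this[of "gap p - 1"] have "agree x (p + gap p) (q + gap p) n" using gap(1)[of p] by simp
    then have "?O (q + gap p)" using gap(2)[of p] agree_trans by blast
    then show ?thesis using gap(1)[of p] by (subst gap_def) (intro Least_le conjI)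
  qed
  have gap_eq: "gap p = gap q" if "?O p" "?O q" "x (p + n) = x (q + n)" for p q
    using gap_le[of p q] gap_le[of q p] that by simp
  have "special_level x n r \<alpha> \<beta> (gap r) (gap r')"
  proof
    show "?O (p + gap r)" if "?O p" "x (p + n) = \<alpha>" for p
      using gap(2)[of p] gap_eq[of p r] that by (simp add: \<alpha>_def)
    show "?O (p + gap r')" if "?O p" "x (p + n) = \<beta>" for p
      using gap(2)[of p] gap_eq[of p r'] that r by (simp add: \<beta>_def)
    show "\<not> ?O (p + i)" if "?O p" "x (p + n) = \<alpha>" "0 < i" "i < gap r" for p i
      using gap_least[of i p] gap_eq[of p r] that by (simp add: \<alpha>_def)
    show "\<not> ?O (p + i)" if "?O p" "x (p + n) = \<beta>" "0 < i" "i < gap r'" for p i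
      using gap_least[of i p] gap_eq[of p r'] that r by (simp add: \<beta>_def)
  qed (use letters det inf gap r in \<open>auto simp: \<alpha>_def \<beta>_def\<close>)
  then show ?thesis by blast
qed

section \<open>Return words at a bispecial level\<close>

context special_level
begin

text \<open>The text up to the next R is forced, so a block of length \<open>N\<close> determines
  its distance from that R. This separates blocks when they are counted.\<close>

lemma distance_unique:
  assumes "agree x p q N" "occ (p + d)" "occ (q + e)"
    and "\<And>j. j < d \<Longrightarrow> \<not> occ (p + j)" "\<And>j. j < e \<Longrightarrow> \<not> occ (q + j)"
  shows "d = e"
proof -
  have le: "e \<le> d" if "agree x p q N" "occ (p + d)"
    "\<And>j. j < d \<Longrightarrow> \<not> occ (p + j)" "\<And>j. j < e \<Longrightarrow> \<not> occ (q + j)" for p q d e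
  proof -
    have "agree x p q (N + d)" using agree_extend that by blast
    then have "agree x (p + d) (q + d) N" using agree_shift[of x p q "N + d" d] by simp
    then show ?thesis using occ_cong that(2,4) by (meson not_less)
  qed
  show ?thesis using le[of p q d e] le[of q p e d] assms agree_sym by (metis order_antisym)
qed

lemma run_\<alpha>:
  assumes "\<And>j. j \<le> q \<Longrightarrow> occ (t + j * a) \<and> x (t + j * a + N) = \<alpha>"
  shows "agree x t (t + a) (q * a + N)"
  using assms
proof (induction q)
  case 0
  then show ?case using occ_agree[of t "t + a"] occ_\<alpha>[of t] by simp
next
  case (Suc q)
  then have "agree x t (t + a) (q * a)" by (auto intro: agree_mono)
  moreover have "agree x (t + q * a) (t + a + q * a) (a + N)"
    using agree_\<alpha>[of "t + q * a" "t + Suc q * a"] Suc.prems[of q] Suc.prems[of "Suc q"]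
    by (simp add: ac_simps)
  ultimately have "agree x t (t + a) (q * a + (a + N))" by (simp add: agree_add)
  then show ?case by (simp add: ac_simps)
qed

text \<open>In an endless run the positions \<open>t + j * a\<close> would be all occurrences of R
  from \<open>t\<close> on, against \<open>inf_\<beta>\<close>.\<close>

lemma ex_run_\<alpha>:
  assumes t: "occ t" "x (t + N) = \<alpha>"
  obtains q where "\<And>j. j \<le> q \<Longrightarrow> occ (t + j * a) \<and> x (t + j * a + N) = \<alpha>"
    and "occ (t + Suc q * a)" "x (t + Suc q * a + N) = \<beta>"
proof -
  let ?P = "\<lambda>j. occ (t + j * a) \<and> x (t + j * a + N) = \<alpha>"
  have "\<exists>j. \<not> ?P j"
  proof (rule ccontr)
    assume "\<not> ?thesis"
    then have all: "?P j" for j by blast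
    obtain s where s: "s \<ge> t" "occ s" "x (s + N) = \<beta>" using inf_\<beta> by (auto simp: occ_def)
    define j where "j = (s - t) div a"
    define i where "i = (s - t) mod a"
    have s_eq: "s = t + j * a + i"
      using s(1) div_mult_mod_eq[of "s - t" a] unfolding j_def i_def by simp
    have "i < a" using return_pos by (simp add: i_def)
    then show False
      using all[of j] s s_eq first_\<alpha>[of "t + j * a" i] distinct
      by (cases "i = 0") (auto simp: occ_def)
  qed
  then obtain k where k: "\<not> ?P k" "\<And>j. j < k \<Longrightarrow> ?P j"
    using exists_least_iff[of "\<lambda>j. \<not> ?P j"] by auto
  have "k \<noteq> 0" using k(1) t by (intro notI) simp
  then obtain q where q: "k = Suc q" by (cases k) auto
  have "occ (t + q * a + a)" using k(2)[of q] q occ_\<alpha>[of "t + q * a"] by simp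
  then have occ: "occ (t + Suc q * a)" by (simp add: ac_simps)
  then have "x (t + Suc q * a + N) = \<beta>" using k(1) q letters by (auto simp: occ_def)
  then show ?thesis using that[of q] k(2) q occ by simp
qed

lemma run_\<beta>:
  assumes "\<And>j. j \<le> q \<Longrightarrow> occ (t + j * b) \<and> x (t + j * b + N) = \<beta>"
  shows "agree x t (t + b) (q * b + N)"
  using special_level.run_\<alpha>[OF swap, of q t] assms by blast

lemma ex_run_\<beta>:
  assumes t: "occ t" "x (t + N) = \<beta>"
  obtains q where "\<And>j. j \<le> q \<Longrightarrow> occ (t + j * b) \<and> x (t + j * b + N) = \<beta>"
    and "occ (t + Suc q * b)" "x (t + Suc q * b + N) = \<alpha>"
  using special_level.ex_run_\<alpha>[OF swap] assms that by blast

end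

context bispecial_level
begin

lemma swap_bispecial: "bispecial_level x N r \<beta> \<alpha> b a"
proof -
  interpret s: special_level x N r \<beta> \<alpha> b a by (rule swap)
  show ?thesis
    using left_special by unfold_locales metis
qed

text \<open>
  Factors of length \<open>N\<close> at different distances from the next occurrence of \<open>R\<close> are distinct. At equal
  distances, the occurrences of \<open>R\<close> reached must be preceded by common letters, which is excluded
  between the two returns and, by the choice of \<open>u\<close>, between the prefix and the returns.
\<close>

lemma complexity_ge_returns:
  assumes fin: "finite (range x)" and u: "u \<le> first"
    and no_\<alpha>: "\<And>d t. occ t \<Longrightarrow> x (t + N) = \<alpha> \<Longrightarrow> first - u < d \<Longrightarrow> d \<le> first \<Longrightarrow> d \<le> a \<Longrightarrow>
      \<not> agree x (first - d) (t + a - d) d"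
    and no_\<beta>: "\<And>d t. occ t \<Longrightarrow> x (t + N) = \<beta> \<Longrightarrow> first - u < d \<Longrightarrow> d \<le> first \<Longrightarrow> d \<le> b \<Longrightarrow>
      \<not> agree x (first - d) (t + b - d) d"
  shows "a + b + u \<le> complexity N x + 1"
proof -
  obtain t where t: "occ t" "x (t + N) = \<alpha>" using inf_\<alpha> by (auto simp: occ_def)
  obtain s where s: "occ s" "x (s + N) = \<beta>" using inf_\<beta> by (auto simp: occ_def)
  \<comment> \<open>There are \<open>u\<close> positions in the prefix, \<open>a\<close> along an
    \<alpha>-return including the R at its end, and \<open>b - 1\<close> strictly inside a
    \<beta>-return. R is counted once, whence the \<open>+ 1\<close> in the claim.\<close>
  define S1 where "S1 = {..<u}"
  define S2 where "S2 = {t<..t + a}"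
  define S3 where "S3 = {s<..<s + b}"
  have d1: "occ (p + (first - p))" "j < first - p \<Longrightarrow> \<not> occ (p + j)" if "p \<in> S1" for p j
    using that u occ_first first_le[of "p + j"] by (auto simp: S1_def)
  have d2: "occ (p + (t + a - p))" "j < t + a - p \<Longrightarrow> \<not> occ (p + j)" if "p \<in> S2" for p j
  proof -
    have p: "t < p" "p \<le> t + a" using that by (auto simp: S2_def)
    then show "occ (p + (t + a - p))" using t occ_\<alpha>[of t] by simp
    show "\<not> occ (p + j)" if "j < t + a - p"
    proof -
      have "0 < p - t + j" "p - t + j < a" using p that by linarith+
      then show ?thesis using first_\<alpha>[of t "p - t + j"] t p by (simp add: occ_def)
    qed
  qed
  have d3: "occ (p + (s + b - p))" "j < s + b - p \<Longrightarrow> \<not> occ (p + j)" if "p \<in> S3" for p j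
  proof -
    have p: "s < p" "p \<le> s + b" using that by (auto simp: S3_def)
    then show "occ (p + (s + b - p))" using s occ_\<beta>[of s] by simp
    show "\<not> occ (p + j)" if "j < s + b - p"
    proof -
      have "0 < p - s + j" "p - s + j < b" using p that by linarith+
      then show ?thesis using first_\<beta>[of s "p - s + j"] s p by (simp add: occ_def)
    qed
  qed
  have e11: "p = q" if "p \<in> S1" "q \<in> S1" "agree x p q N" for p q
  proof -
    have "first - p = first - q" using distance_unique[OF that(3)] d1 that by blast
    then show ?thesis using that u by (auto simp: S1_def)
  qed
  have e22: "p = q" if "p \<in> S2" "q \<in> S2" "agree x p q N" for p q
  proof -
    have "t + a - p = t + a - q" using distance_unique[OF that(3)] d2 that by blast
    then show ?thesis using that by (auto simp: S2_def)
  qed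
  have e33: "p = q" if "p \<in> S3" "q \<in> S3" "agree x p q N" for p q
  proof -
    have "s + b - p = s + b - q" using distance_unique[OF that(3)] d3 that by blast
    then show ?thesis using that by (auto simp: S3_def)
  qed
  have e12: False if "p \<in> S1" "q \<in> S2" "agree x p q N" for p q
  proof -
    have eq: "first - p = t + a - q" using distance_unique[OF that(3)] d1 d2 that by blast
    have "agree x p q (N + (first - p))" using agree_extend d1 that by blast
    then have "agree x p q (first - p)" by (rule agree_mono) simp
    moreover have "first - (first - p) = p" "t + a - (first - p) = q" "first - u < first - p"
      "first - p \<le> a"
      using eq that u by (auto simp: S1_def S2_def)
    ultimately show False using no_\<alpha>[OF t, of "first - p"] by simp
  qed
  have e13: False if "p \<in> S1" "q \<in> S3" "agree x p q N" for p q
  proof -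
    have eq: "first - p = s + b - q" using distance_unique[OF that(3)] d1 d3 that by blast
    have "agree x p q (N + (first - p))" using agree_extend d1 that by blast
    then have "agree x p q (first - p)" by (rule agree_mono) simp
    moreover have "first - (first - p) = p" "s + b - (first - p) = q" "first - u < first - p"
      "first - p \<le> b"
      using eq that u by (auto simp: S1_def S3_def)
    ultimately show False using no_\<beta>[OF s, of "first - p"] by simp
  qed
  have e23: False if "p \<in> S2" "q \<in> S3" "agree x p q N" for p q
  proof -
    have eq: "t + a - p = s + b - q" using distance_unique[OF that(3)] d2 d3 that by blast
    have "agree x p q (N + (t + a - p))" using agree_extend d2 that by blast
    moreover have "t + a - p > 0" using eq that by (auto simp: S3_def)
    ultimately have "x (p + (t + a - p - 1)) = x (q + (t + a - p - 1))"
      by (intro agree_nth[of x p q "N + (t + a - p)"]) auto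
    moreover have "p + (t + a - p - 1) = t + a - 1" "q + (t + a - p - 1) = s + b - 1"
      using eq that \<open>t + a - p > 0\<close> by (auto simp: S2_def S3_def)
    ultimately show False using left_special[OF t s] by simp
  qed
  have inj: "inj_on (\<lambda>p. factor x p N) (S1 \<union> S2 \<union> S3)"
  proof (rule inj_onI)
    fix p q assume pq: "p \<in> S1 \<union> S2 \<union> S3" "q \<in> S1 \<union> S2 \<union> S3" "factor x p N = factor x q N"
    then have "agree x p q N" "agree x q p N" by (auto simp: factor_eq_iff_agree intro: agree_sym)
    then show "p = q" using pq(1,2) e11 e22 e33 e12 e13 e23 by blast
  qed
  have disj: "S1 \<inter> S2 = {}" "(S1 \<union> S2) \<inter> S3 = {}"
    using e12 e13 e23 agree_refl by blast+
  have "u + a + (b - 1) = card (S1 \<union> S2 \<union> S3)"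
    using disj by (simp add: card_Un_disjoint S1_def S2_def S3_def)
  also have "\<dots> \<le> complexity N x"
    unfolding complexity_def card_image[OF inj, symmetric]
    by (intro card_mono finite_factors fin) auto
  finally show ?thesis using return_pos by simp
qed

text \<open>For \<open>1 \<le> k \<le> min a b\<close>, the last \<open>k\<close> letters of A
  followed by R are right special, as AA and AB occur; likewise for B. The two factors differ
  because A and B end differently.\<close>

lemma complexity_ge_four_returns:
  assumes fin: "finite (range x)"
    and "occ t" "x (t + N) = \<alpha>" "x (t + a + N) = \<alpha>" "occ t'" "x (t' + N) = \<alpha>" "x (t' + a + N) = \<beta>"
    and "occ s" "x (s + N) = \<beta>" "x (s + b + N) = \<alpha>" "occ s'" "x (s' + N) = \<beta>" "x (s' + b + N) = \<beta>"
  shows "complexity N x + 1 + 2 * min a b \<le> complexity (Suc N + min a b) x"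
proof -
  have "complexity N x + 1 + 2 * i \<le> complexity (Suc N + i) x" if "i \<le> min a b" for i
    using that
  proof (induction i)
    case 0
    show ?case
      using complexity_Suc_ge1[OF fin occ_agree[of t s]] assms distinct by simp
  next
    case (Suc i)
    let ?k = "Suc i"
    have k: "?k \<le> a" "?k \<le> b" using Suc.prems by auto
    have A: "agree x (t + (a - ?k)) (t' + (a - ?k)) (N + ?k)"
      using agree_shift[OF agree_\<alpha>[of t t'], of "a - ?k"] assms k by (simp add: ac_simps)
    have B: "agree x (s + (b - ?k)) (s' + (b - ?k)) (N + ?k)"
      using agree_shift[OF agree_\<beta>[of s s'], of "b - ?k"] assms k by (simp add: ac_simps)
    have "\<not> agree x (t + (a - ?k)) (s + (b - ?k)) (N + ?k)"
    proof
      assume "agree x (t + (a - ?k)) (s + (b - ?k)) (N + ?k)"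
      then have "x (t + (a - ?k) + i) = x (s + (b - ?k) + i)" by (rule agree_nth) simp
      moreover have "t + (a - ?k) + i = t + a - 1" "s + (b - ?k) + i = s + b - 1" using k by auto
      ultimately show False using left_special[of t s] assms by simp
    qed
    moreover have "t + (a - ?k) + (N + ?k) = t + a + N" "t' + (a - ?k) + (N + ?k) = t' + a + N"
      "s + (b - ?k) + (N + ?k) = s + b + N" "s' + (b - ?k) + (N + ?k) = s' + b + N"
      using k by auto
    ultimately have "complexity (N + ?k) x + 2 \<le> complexity (Suc (N + ?k)) x"
      using complexity_Suc_ge2[OF fin A _ B] assms distinct by metis
    then show ?case using Suc by simp
  qed
  then show ?thesis by blast
qed

end

section \<open>Early repetitions forced by the first returns\<close>

context bispecial_level
begin

text \<open>Here \<open>l\<close> is the length of the longest common suffix of P and A; P and B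
  have none. That suffix followed by R recurs after \<open>a\<close> letters, and R has period
  \<open>b\<close>.\<close>

lemma left_agreement_\<alpha>:
  assumes fin: "finite (range x)" and \<alpha>: "x (first + N) = \<alpha>"
    and last: "first \<ge> 1" "x (first - 1) = x (first + a - 1)"
  obtains u l where "a + b + u \<le> complexity N x + 1"
    "repetition (N + l) x \<le> u + a" "repetition (N - b) x \<le> u + l + b"
proof -
  let ?P = "\<lambda>l. l \<le> first \<and> l \<le> a \<and> agree x (first - l) (first + a - l) l"
  have "?P 0" by (simp add: agree_def)
  moreover have "l \<le> first" if "?P l" for l using that by simp
  ultimately obtain l where l: "?P l" "\<And>d. ?P d \<Longrightarrow> d \<le> l"
    using GreatestI_nat[of ?P 0 first] Greatest_le_nat[of ?P _ first] by blast
  define u where "u = first - l"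
  have first: "first = u + l" using l(1) by (simp add: u_def)
  have ul: "agree x u (u + a) l" using l(1) by (simp add: first)
  have "a + b + u \<le> complexity N x + 1"
  proof (rule complexity_ge_returns[OF fin])
    show "u \<le> first" by (simp add: first)
  next
    fix d t assume d: "first - u < d" "d \<le> first" and t: "occ t" "x (t + N) = \<alpha>" and "d \<le> a"
    have "agree x (first + (a - d)) (t + (a - d)) d"
      by (rule agree_mono[OF agree_shift[OF agree_\<alpha>[OF occ_first t(1) \<alpha> t(2)], of "a - d"]])
        (use \<open>d \<le> a\<close> in auto)
    then have shift: "agree x (first + a - d) (t + a - d) d" using \<open>d \<le> a\<close> by simp
    show "\<not> agree x (first - d) (t + a - d) d"
    proof
      assume "agree x (first - d) (t + a - d) d"
      then have "agree x (first - d) (first + a - d) d"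
        using shift by (blast intro: agree_sym agree_trans)
      then have "d \<le> l" using l(2)[of d] d \<open>d \<le> a\<close> by simp
      then show False using d by (simp add: first)
    qed
  next
    fix d t assume d: "first - u < d" "d \<le> first" and t: "occ t" "x (t + N) = \<beta>" and "d \<le> b"
    show "\<not> agree x (first - d) (t + b - d) d"
    proof
      assume "agree x (first - d) (t + b - d) d"
      then have "x (first - d + (d - 1)) = x (t + b - d + (d - 1))"
        by (rule agree_nth) (use d in simp)
      moreover have "first - d + (d - 1) = first - 1" "t + b - d + (d - 1) = t + b - 1"
        using d \<open>d \<le> b\<close> by auto
      ultimately show False using left_special[OF occ_first \<alpha> t] last by simp
    qed
  qed
  moreover have "agree x (u + l) (u + a + l) N"
    using occ_agree[OF occ_first occ_\<alpha>[OF occ_first \<alpha>]] by (simp add: first ac_simps)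
  then have "agree x u (u + a) (l + N)" using ul by (simp add: agree_add)
  then have "repetition (N + l) x \<le> u + a"
    using return_pos by (intro repetition_le) (auto simp: add.commute)
  moreover obtain s where s: "occ s" "x (s + N) = \<beta>" using inf_\<beta> by (auto simp: occ_def)
  \<comment> \<open>The first R is followed by \<alpha>, so its period \<open>b\<close> is read off
    at an occurrence followed by \<beta>.\<close>
  have "agree x first (first + b) (N - b)"
  proof -
    have "agree x first s (N - b)" using agree_mono[OF occ_agree[OF occ_first s(1)]] by simp
    moreover have "agree x s (s + b) (N - b)"
      using agree_mono[OF occ_agree[OF s(1) occ_\<beta>[OF s]]] by simp
    moreover have "agree x (s + b) (first + b) (N - b)"
      using agree_shift[OF occ_agree[OF s(1) occ_first], of b]
      by (cases "b \<le> N") (auto simp: agree_def)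
    ultimately show ?thesis by (blast intro: agree_trans)
  qed
  then have "repetition (N - b) x \<le> u + l + b"
    using return_pos repetition_le[of x first "first + b" "N - b"] by (simp add: first)
  ultimately show ?thesis by (rule that)
qed

text \<open>P and A have no common suffix, so \<open>l\<close> measures the one with B and may be 0.
  The agreement is stated at the end of every B, since the place of the first B depends on the order
  of the returns.\<close>

lemma left_agreement_\<beta>:
  assumes fin: "finite (range x)" and \<alpha>: "x (first + N) = \<alpha>"
    and last: "\<not> (first \<ge> 1 \<and> x (first - 1) = x (first + a - 1))"
  obtains u l where "first = u + l" "l \<le> b" "a + b + u \<le> complexity N x + 1"
    "\<And>s. occ s \<Longrightarrow> x (s + N) = \<beta> \<Longrightarrow> agree x u (s + b - l) (l + N)"
proof -
  obtain s where s: "occ s" "x (s + N) = \<beta>" using inf_\<beta> by (auto simp: occ_def)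
  let ?P = "\<lambda>l. l \<le> first \<and> l \<le> b \<and> agree x (first - l) (s + b - l) l"
  have "?P 0" by (simp add: agree_def)
  moreover have "l \<le> first" if "?P l" for l using that by simp
  ultimately obtain l where l: "?P l" "\<And>d. ?P d \<Longrightarrow> d \<le> l"
    using GreatestI_nat[of ?P 0 first] Greatest_le_nat[of ?P _ first] by blast
  define u where "u = first - l"
  have first: "first = u + l" using l(1) by (simp add: u_def)
  have swap_s: "agree x (s + b - d) (t + b - d) (d + N)"
    if t: "occ t" "x (t + N) = \<beta>" and d: "d \<le> b" for t d
  proof -
    have "agree x (s + (b - d)) (t + (b - d)) (b - (b - d))"
      using agree_shift[OF agree_\<beta>[OF s(1) t(1) s(2) t(2)], of "b - d"]
      by (rule agree_mono) auto
    then have "agree x (s + b - d) (t + b - d) d" using d by simp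
    moreover have "agree x (s + b - d + d) (t + b - d + d) N"
      using occ_agree[OF occ_\<beta>[OF s] occ_\<beta>[OF t]] d by simp
    ultimately show ?thesis by (simp add: agree_add)
  qed
  have "a + b + u \<le> complexity N x + 1"
  proof (rule complexity_ge_returns[OF fin])
    show "u \<le> first" by (simp add: first)
  next
    fix d t assume d: "first - u < d" "d \<le> first" and t: "occ t" "x (t + N) = \<beta>" and "d \<le> b"
    have "agree x (t + b - d) (s + b - d) d"
      by (rule agree_sym[OF agree_mono[OF swap_s[OF t \<open>d \<le> b\<close>]]]) simp
    show "\<not> agree x (first - d) (t + b - d) d"
    proof
      assume "agree x (first - d) (t + b - d) d"
      then have "agree x (first - d) (s + b - d) d"
        using \<open>agree x (t + b - d) (s + b - d) d\<close> by (rule agree_trans)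
      then have "d \<le> l" using l(2)[of d] d \<open>d \<le> b\<close> by simp
      then show False using d by (simp add: first)
    qed
  next
    fix d t assume d: "first - u < d" "d \<le> first" and t: "occ t" "x (t + N) = \<alpha>" and "d \<le> a"
    show "\<not> agree x (first - d) (t + a - d) d"
    proof
      assume "agree x (first - d) (t + a - d) d"
      then have "x (first - d + (d - 1)) = x (t + a - d + (d - 1))"
        by (rule agree_nth) (use d in simp)
      moreover have "first - d + (d - 1) = first - 1" "t + a - d + (d - 1) = t + (a - 1)"
        using d \<open>d \<le> a\<close> by auto
      moreover have "x (t + (a - 1)) = x (first + (a - 1))"
        using agree_nth[OF agree_\<alpha>[OF t(1) occ_first t(2) \<alpha>], of "a - 1"] return_pos by simp
      ultimately show False using last d return_pos by simp
    qed
  qed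
  moreover have "agree x u (t + b - l) (l + N)" if t: "occ t" "x (t + N) = \<beta>" for t
  proof -
    have "agree x u (s + b - l) l" using l(1) by (simp add: u_def)
    moreover have "agree x (u + l) (s + b - l + l) N"
      using occ_agree[OF occ_first occ_\<beta>[OF s]] l(1) by (simp add: first)
    ultimately have "agree x u (s + b - l) (l + N)" by (simp add: agree_add)
    then show ?thesis using swap_s[OF t, of l] l(1) by (blast intro: agree_trans)
  qed
  ultimately show ?thesis using that first l(1) by blast
qed

text \<open>
  With \<open>x = P A\<^sup>q\<^sup>+\<^sup>1 B\<^sup>s\<^sup>+\<^sup>1 A \<dots>\<close>, the cases are: \<open>P\<close> and \<open>A\<close> end with the same letter; otherwise \<open>s = 0\<close>;
  \<open>q, s > 0\<close>; and \<open>q = 0 < s\<close>, where the return after \<open>P A B\<^sup>s\<^sup>+\<^sup>1 A\<close> is \<open>B\<close> or \<open>A\<close>. The parameter \<open>q\<close> of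
  \<open>many_\<beta>\<close> is this \<open>s\<close>. Truncated subtraction is harmless here, as the repetition of the empty
  factor satisfies the same bounds.
\<close>

lemma first_return_\<alpha>_cases:
  assumes fin: "finite (range x)" and \<alpha>: "x (first + N) = \<alpha>"
  obtains
    (left_\<alpha>) u l where "a + b + u \<le> complexity N x + 1"
      "repetition (N + l) x \<le> u + a" "repetition (N - b) x \<le> u + l + b"
  | (single_\<beta>) u l q where "a + b + u \<le> complexity N x + 1" "l \<le> b"
      "repetition (N + q * a) x \<le> u + l + a" "repetition (N + l + a) x \<le> u + Suc q * a + b"
  | (many_\<alpha>) u l where "a + b + u \<le> complexity N x + 1" "l \<le> b"
      "complexity N x + 1 + 2 * min a b \<le> complexity (Suc N + min a b) x"
      "repetition (N + a) x \<le> u + l + a" "repetition (N + l - b) x \<le> u + b"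
      "repetition (min l (N + l - b) - a) x \<le> u + a"
  | (many_\<beta>) u l q where "a + b + u \<le> complexity N x + 1" "l \<le> b"
      "repetition N x \<le> u + l + a" "repetition (N + l) x \<le> u + a + b"
      "repetition (N + q * b) x \<le> u + l + a + b" "repetition (N + l + a + b) x \<le> u + a + Suc q * b"
  | (four_returns) u l where "a + b + u \<le> complexity N x + 1" "l \<le> b"
      "complexity N x + 1 + 2 * min a b \<le> complexity (Suc N + min a b) x"
      "repetition N x \<le> u + l + a" "repetition (N + l) x \<le> u + a + b"
      "repetition (N + l - b) x \<le> u + b"
proof (cases "first \<ge> 1 \<and> x (first - 1) = x (first + a - 1)")
  case True
  then show ?thesis using left_agreement_\<alpha>[OF fin \<alpha>] left_\<alpha> by blast
next
  case False
  obtain u l where first: "first = u + l" and "l \<le> b" and count: "a + b + u \<le> complexity N x + 1"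
    and left: "\<And>s. occ s \<Longrightarrow> x (s + N) = \<beta> \<Longrightarrow> agree x u (s + b - l) (l + N)"
    using left_agreement_\<beta>[OF fin \<alpha> False] by blast
  obtain q where q: "\<And>j. j \<le> q \<Longrightarrow> occ (first + j * a) \<and> x (first + j * a + N) = \<alpha>"
    and t: "occ (first + Suc q * a)" "x (first + Suc q * a + N) = \<beta>"
    using ex_run_\<alpha>[OF occ_first \<alpha>] by blast
  define t where "t = first + Suc q * a"
  note t = t[folded t_def]
  have Vq: "repetition (N + q * a) x \<le> u + l + a"
    using repetition_le[OF run_\<alpha>[of q first]] q return_pos by (simp add: first add.commute)
  have V0: "repetition N x \<le> u + l + a"
    using repetition_le[OF occ_agree[OF occ_first occ_\<alpha>[OF occ_first \<alpha>]]] return_pos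
    by (simp add: first)
  have X: "repetition (N + l) x \<le> u + Suc q * a + b"
    using repetition_le[OF left[OF t]] \<open>l \<le> b\<close> return_pos by (simp add: t_def first add.commute)
  \<comment> \<open>The block of length \<open>N + l\<close> at \<open>u\<close> is a suffix of B
    followed by R, which has period \<open>b\<close>.\<close>
  have UB: "repetition (N + l - b) x \<le> u + b"
  proof -
    have "agree x u (u + b) (N + l - b)"
      unfolding agree_def
    proof (intro allI impI)
      fix i assume i: "i < N + l - b"
      have "x (u + i) = x (t + b - l + i)" using agree_nth[OF left[OF t], of i] i by simp
      also have "\<dots> = x (t + (b - l + i))" using \<open>l \<le> b\<close> by (simp add: add.assoc)
      also have "\<dots> = x (t + b + (b - l + i))"
        using agree_nth[OF occ_agree[OF t(1) occ_\<beta>[OF t]], of "b - l + i"] i \<open>l \<le> b\<close> by simp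
      also have "\<dots> = x (t + b - l + (b + i))"
        using \<open>l \<le> b\<close> by (intro arg_cong[of _ _ x]) simp
      also have "\<dots> = x (u + (b + i))" using agree_nth[OF left[OF t], of "b + i"] i by simp
      finally show "x (u + i) = x (u + b + i)" by (simp add: add.assoc)
    qed
    then show ?thesis using return_pos by (intro repetition_le) auto
  qed
  \<comment> \<open>R has period \<open>a\<close>. The last \<open>l\<close> letters of B start at
    offset \<open>b - l\<close>, and their part inside the R at \<open>t\<close> inherits this
    period.\<close>
  have W: "repetition (min l (N + l - b) - a) x \<le> u + a"
  proof -
    have t_nth: "x (t + j) = x (t + j + a)" if "j + a < N" for j
    proof -
      have "x (t + j) = x (first + a + j)"
        using agree_nth[OF occ_agree[OF t(1) occ_\<alpha>[OF occ_first \<alpha>]], of j] that by simp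
      also have "\<dots> = x (first + (j + a))" by (simp add: ac_simps)
      also have "\<dots> = x (t + (j + a))"
        using agree_nth[OF occ_agree[OF occ_first t(1)], of "j + a"] that by simp
      finally show ?thesis by (simp add: ac_simps)
    qed
    have "agree x u (u + a) (min l (N + l - b) - a)"
      unfolding agree_def
    proof (intro allI impI)
      fix i assume i: "i < min l (N + l - b) - a"
      have "x (u + i) = x (t + b - l + i)" using agree_nth[OF left[OF t], of i] i by simp
      also have "\<dots> = x (t + (b - l + i))" using \<open>l \<le> b\<close> by (simp add: add.assoc)
      also have "\<dots> = x (t + (b - l + i) + a)" using t_nth[of "b - l + i"] i \<open>l \<le> b\<close> by simp
      also have "\<dots> = x (t + b - l + (a + i))"
        using \<open>l \<le> b\<close> by (intro arg_cong[of _ _ x]) simp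
      also have "\<dots> = x (u + (a + i))" using agree_nth[OF left[OF t], of "a + i"] i by simp
      finally show "x (u + i) = x (u + a + i)" by (simp add: add.assoc)
    qed
    then show ?thesis using return_pos by (intro repetition_le) auto
  qed
  obtain s where s: "\<And>j. j \<le> s \<Longrightarrow> occ (t + j * b) \<and> x (t + j * b + N) = \<beta>"
    and v: "occ (t + Suc s * b)" "x (t + Suc s * b + N) = \<alpha>"
    using ex_run_\<beta>[OF t] by blast
  define v where "v = t + Suc s * b"
  note v = v[folded v_def]
  have vb: "v = t + s * b + b" by (simp add: v_def)
  have left_v: "agree x u (v - l) (l + N)"
    using left[of "t + s * b"] s[of s] by (simp add: vb)
  have "v - l + l = v" using \<open>l \<le> b\<close> by (simp add: vb)
  \<comment> \<open>The last B of the run is followed by A, as P is, so the agreement of their ends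
    extends through A and the next R.\<close>
  have left_va: "agree x u (v - l) (N + l + a)"
  proof -
    have "agree x u (v - l) l" using left_v by (rule agree_mono) simp
    moreover have "agree x (u + l) (v - l + l) (a + N)"
      using agree_\<alpha>[OF occ_first v(1) \<alpha> v(2)] \<open>v - l + l = v\<close> by (simp add: first)
    ultimately have "agree x u (v - l) (l + (a + N))" by (simp add: agree_add)
    then show ?thesis by (simp add: ac_simps)
  qed
  have v_gt: "u < v - l" using \<open>v - l + l = v\<close> return_pos by (simp add: v_def t_def first)
  show ?thesis
  proof (cases "s = 0")
    case True
    have "v - l = u + Suc q * a + b" using True by (simp add: v_def t_def first)
    then show ?thesis using single_\<beta> count \<open>l \<le> b\<close> Vq repetition_le[OF left_va v_gt] by simp
  next
    case s0: False
    show ?thesis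
    proof (cases "q = 0")
      case False
      \<comment> \<open>AA, AB, BA and BB are read at \<open>first\<close>,
        \<open>first + q * a\<close>, \<open>t + s * b\<close> and \<open>t\<close>.\<close>
      have "complexity N x + 1 + 2 * min a b \<le> complexity (Suc N + min a b) x"
        using q[of 0] q[of 1] q[of q] t s[of 0] s[of 1] s[of s] v False s0
        by (intro complexity_ge_four_returns[OF fin, of first "first + q * a" "t + s * b" t])
          (auto simp: vb t_def ac_simps)
      moreover have "repetition (N + a) x \<le> u + l + a"
      proof -
        have "agree x first (first + a) (q * a + N)" using run_\<alpha>[of q first] q by blast
        moreover have "N + a \<le> q * a + N" using False by (cases q) auto
        ultimately show ?thesis
          using return_pos repetition_le[OF agree_mono, of x first "first + a"] by (simp add: first)
      qed
      ultimately show ?thesis using many_\<alpha> count \<open>l \<le> b\<close> UB W by blast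
    next
      case True
      have t_eq: "t = first + a" using True by (simp add: t_def)
      have X0: "repetition (N + l) x \<le> u + a + b" using X True by simp
      have va: "occ (v + a)" using occ_\<alpha>[OF v] .
      show ?thesis
      proof (cases "x (v + a + N) = \<alpha>")
        case aa: True
        have "complexity N x + 1 + 2 * min a b \<le> complexity (Suc N + min a b) x"
          using t s[of 0] s[of 1] s[of s] v va aa s0 occ_first \<alpha>
          by (intro complexity_ge_four_returns[OF fin, of v first "t + s * b" t])
            (auto simp: vb t_eq ac_simps)
        then show ?thesis using four_returns count \<open>l \<le> b\<close> V0 X0 UB by blast
      next
        case False
        then have \<beta>: "x (v + a + N) = \<beta>" using va letters by (auto simp: occ_def)
        have "repetition (N + s * b) x \<le> u + l + a + b"
          using repetition_le[OF run_\<beta>[of s t]] s return_pos by (simp add: t_eq first add.commute)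
        \<comment> \<open>The A after P and the A at \<open>v\<close> are both followed by B, so the
          agreement extends through B as well.\<close>
        moreover have "repetition (N + l + a + b) x \<le> u + a + Suc s * b"
        proof -
          have "agree x u (v - l) (l + a)" using left_va by (rule agree_mono) simp
          moreover have "agree x (u + (l + a)) (v - l + (l + a)) (b + N)"
            using agree_\<beta>[OF t(1) va t(2) \<beta>] \<open>v - l + l = v\<close>
            by (simp add: t_eq first add.assoc[symmetric])
          ultimately have "agree x u (v - l) (l + a + (b + N))" by (simp only: agree_add)
          moreover have "v - l = u + a + Suc s * b" by (simp add: v_def t_eq first)
          ultimately show ?thesis using repetition_le[of x u "v - l"] v_gt by (simp add: ac_simps)
        qed
        ultimately show ?thesis using many_\<beta> count \<open>l \<le> b\<close> V0 X0 by blast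
      qed
    qed
  qed
qed

end

section \<open>The numerical contradiction\<close>

text \<open>
  The constants \<open>8/5\<close> and \<open>5/24\<close> come from linear programming: on the line \<open>\<rho> = 4/3 - 8d/5\<close>, with
  \<open>0 < d \<le> 5/24\<close> so that \<open>\<rho> \<ge> 1\<close>, all cases are infeasible. The theorem only needs the smaller
  \<open>d = (4 - 3\<rho>)/(2 (1 + 2\<rho>) (2 - \<rho>))\<close>, whose denominator exceeds \<open>24/5\<close>. The number \<open>J\<close> absorbs
  the additive constants.
\<close>

context
  fixes d N a b u l J :: real
  assumes d: "0 \<le> d" "d \<le> 5/24" and J: "0 \<le> J"
    and nonneg: "0 \<le> N" "0 \<le> a" "0 \<le> b" "0 \<le> u" "0 \<le> l"
    and returns: "N \<le> a + b"
    and count: "a + b + u \<le> 4/3 * N - 8/5 * (d * N) + J"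
begin

text \<open>Linear arithmetic treats the products of \<open>d\<close> with the other quantities as
  new unknowns and needs \<open>0 \<le> d * y \<le> 5/24 * y\<close> for them.\<close>

lemmas product_bounds =
  mult_nonneg_nonneg[OF d(1) nonneg(1)] mult_nonneg_nonneg[OF d(1) nonneg(2)]
  mult_nonneg_nonneg[OF d(1) nonneg(3)] mult_nonneg_nonneg[OF d(1) nonneg(4)]
  mult_nonneg_nonneg[OF d(1) nonneg(5)]
  mult_right_mono[OF d(2) nonneg(1)] mult_right_mono[OF d(2) nonneg(2)]
  mult_right_mono[OF d(2) nonneg(3)] mult_right_mono[OF d(2) nonneg(4)]
  mult_right_mono[OF d(2) nonneg(5)]

lemma bound_left_\<alpha>:
  assumes "N + l - d * N - d * l \<le> u + a + J" "N - b - d * N + d * b \<le> u + l + b + J"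
  shows "d * N \<le> 20 * J"
  using assms product_bounds nonneg returns count J d by linarith

lemma bound_single_\<beta>:
  assumes "l \<le> b" "0 \<le> v" "N + v - d * N - d * v \<le> u + l + a + J"
    "N + l + a - d * N - d * l - d * a \<le> u + v + a + b + J"
  shows "d * N \<le> 20 * J"
  using assms product_bounds mult_nonneg_nonneg[OF d(1) assms(2)] mult_right_mono[OF d(2) assms(2)]
    nonneg returns count J d by linarith

lemma bound_many_\<alpha>:
  assumes "l \<le> b" and four: "a + b + u + 2 * min a b
      \<le> 4/3 * (N + min a b) - 8/5 * (d * N) - 8/5 * (d * min a b) + J"
    and "N + a - d * N - d * a \<le> u + l + a + J" "N + l - b - d * N - d * l + d * b \<le> u + b + J"
    and W: "(1 - d) * (min l (N + l - b) - a) \<le> u + a + J"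
  shows "d * N \<le> 20 * J"
proof (cases "a \<le> b")
  case True
  then have Q: "a + b + u + 2 * a \<le> 4/3 * (N + a) - 8/5 * (d * N) - 8/5 * (d * a) + J" using four by (simp add: min_def)
  show ?thesis
  proof (cases "b \<le> N")
    case True
    then have "l - a - d * l + d * a \<le> u + a + J"
      using W by (simp add: min_def algebra_simps split: if_splits)
    then show ?thesis
      using assms(1,3) Q product_bounds(2,10) nonneg(4) returns J by argo
  next
    case False
    then have "N + l - b - a - d * N - d * l + d * b + d * a \<le> u + a + J"
      using W by (simp add: min_def algebra_simps split: if_splits)
    then show ?thesis
      using assms(1,3) Q False product_bounds nonneg returns count J d by linarith
  qed
next
  case False
  then have Q: "a + b + u + 2 * b \<le> 4/3 * (N + b) - 8/5 * (d * N) - 8/5 * (d * b) + J" using four by (simp add: min_def)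
  then show ?thesis
    using assms(1,3,4) False product_bounds nonneg returns count J d by linarith
qed

text \<open>Eliminating \<open>w\<close> between \<open>V\<close> and \<open>Z\<close> takes a
  multiplication of \<open>Z\<close> by \<open>1 - d\<close>, which makes the problem quadratic in
  \<open>d\<close>.\<close>

lemma bound_many_\<beta>:
  assumes "l \<le> b" "0 \<le> w"
    and X: "N + l - d * N - d * l \<le> u + a + b + J"
    and V: "N + w - d * N - d * w \<le> u + l + a + b + J"
    and Z: "(1 - d) * (N + l + a + b) \<le> u + a + w + b + J"
  shows "d * N \<le> 20 * J"
proof -
  define M where "M = N + l + a + b"
  have "(1 - d) * ((1 - d) * M) \<le> (1 - d) * (u + a + w + b + J)"
    using Z d by (intro mult_left_mono) (auto simp: M_def)
  moreover have "(1 - d) * ((1 - d) * M) = M - 2 * d * M + d * d * M" by (simp add: algebra_simps)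
  moreover have "0 \<le> d * d * M" using d nonneg by (simp add: M_def)
  moreover have "d * J \<ge> 0" using d J by simp
  ultimately have "2 * N \<le> 2 * u + a + b + 3 * (d * N) + 2 * (d * l) + d * a + d * b - d * u + 2 * J"
    using V by (simp add: M_def algebra_simps)
  \<comment> \<open>The square of \<open>d\<close> is replaced by its tangent at 5/24: 8/5 d^2 is at
    least 2/3 d - 5/72.\<close>
  moreover have "d * a + d * b \<le> 5/72 * N + 2/3 * (d * N) + J"
  proof -
    have "d * (a + b + u) \<le> d * (4/3 * N - 8/5 * (d * N) + J)" using count d by (intro mult_left_mono) auto
    moreover have "d * J \<le> J" using d J by (simp add: mult_left_le_one_le)
    moreover have "d * u \<ge> 0" using d nonneg by simp
    moreover have "0 \<le> 8/5 * (d - 5/24)^2 * N" using nonneg by simp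
    ultimately show ?thesis by (simp add: algebra_simps power2_eq_square)
  qed
  ultimately show ?thesis
    using X product_bounds nonneg returns count J d by linarith
qed

lemma bound_four_returns:
  assumes "l \<le> b" and four: "a + b + u + 2 * min a b
      \<le> 4/3 * (N + min a b) - 8/5 * (d * N) - 8/5 * (d * min a b) + J"
    and "N - d * N \<le> u + l + a + J" "N + l - d * N - d * l \<le> u + a + b + J"
      "N + l - b - d * N - d * l + d * b \<le> u + b + J"
  shows "d * N \<le> 20 * J"
proof (cases "a \<le> b")
  case True
  then have "a + b + u + 2 * a \<le> 4/3 * (N + a) - 8/5 * (d * N) - 8/5 * (d * a) + J" using four by (simp add: min_def)
  then show ?thesis
    using assms(3,4) product_bounds(1,2,10) nonneg(1) returns count J by argo
next
  case False
  then have "a + b + u + 2 * b \<le> 4/3 * (N + b) - 8/5 * (d * N) - 8/5 * (d * b) + J" using four by (simp add: min_def)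
  then show ?thesis
    using assms(3,5) product_bounds(1,3,10) nonneg(1,4) returns J by argo
qed

end

section \<open>The bound on bispecial levels\<close>

lemma (in bispecial_level) level_bound_\<alpha>:
  fixes d J :: real
  assumes fin: "finite (range x)" and \<alpha>: "x (first + N) = \<alpha>"
    and d: "0 \<le> d" "d \<le> 5/24"
    and rep: "\<And>n. (1 - d) * real n \<le> real (repetition n x) + J"
    and compl: "\<And>n. real (complexity n x) \<le> (4/3 - 8/5 * d) * real n + J - 2"
  shows "d * real N \<le> 20 * J"
proof -
  have J: "0 \<le> J"
    using compl[of 0] complexity_ge_returns[OF fin, of 0] return_pos by simp
  have ret: "real N \<le> real a + real b" using return_gt by simp
  have count: "real a + real b + real u \<le> 4/3 * real N - 8/5 * (d * real N) + J"
    if "a + b + u \<le> complexity N x + 1" for u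
    using that compl[of N] by (simp add: algebra_simps)
  \<comment> \<open>The real \<open>z\<close> allows a difference that truncated subtraction on
    naturals may have raised to 0.\<close>
  have repetition: "z - d * z \<le> real m + J" if "repetition n x \<le> m" "z \<le> real n" for n m z
  proof -
    have "(1 - d) * z \<le> (1 - d) * real n" using that d by (intro mult_left_mono) auto
    then show ?thesis using rep[of n] that by (simp add: algebra_simps)
  qed
  have four: "real a + real b + real u + 2 * min (real a) (real b)
      \<le> 4/3 * (real N + min (real a) (real b)) - 8/5 * (d * real N) - 8/5 * (d * min (real a) (real b)) + J"
    if "a + b + u \<le> complexity N x + 1"
      "complexity N x + 1 + 2 * min a b \<le> complexity (Suc N + min a b) x" for u
  proof -
    \<comment> \<open>The extra level in \<open>Suc N\<close> costs at most 4/3, which the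
      \<open>- 2\<close> in \<open>compl\<close> pays for.\<close>
    have "real (a + b + u + 2 * min a b) \<le> real (complexity (Suc N + min a b) x)"
      using that by linarith
    also have "\<dots> \<le> (4/3 - 8/5 * d) * real (Suc N + min a b) + J - 2" by (rule compl)
    also have "(4/3 - 8/5 * d) * real (Suc N + min a b)
        = 4/3 * (real N + real (min a b)) - 8/5 * (d * real N) - 8/5 * (d * real (min a b)) + 4/3 - 8/5 * d"
      by (simp add: field_simps)
    finally show ?thesis unfolding of_nat_min[symmetric] of_nat_add of_nat_mult of_nat_numeral
      using d by linarith
  qed
  show ?thesis
  proof (cases rule: first_return_\<alpha>_cases[OF fin \<alpha>,
      case_names left_\<alpha> single_\<beta> many_\<alpha> many_\<beta> four_returns])
    case (left_\<alpha> u l)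
    show ?thesis
      using repetition[OF left_\<alpha>(2), of "N + l"] repetition[OF left_\<alpha>(3), of "real N - real b"]
      by (intro bound_left_\<alpha>[OF d J _ _ _ _ _ ret count[OF left_\<alpha>(1)], of "real l"])
        (auto simp: algebra_simps)
  next
    case (single_\<beta> u l q)
    show ?thesis
      using repetition[OF single_\<beta>(3), of "N + q * a"] repetition[OF single_\<beta>(4), of "N + l + a"] single_\<beta>(2)
      by (intro bound_single_\<beta>[OF d J _ _ _ _ _ ret count[OF single_\<beta>(1)], of "real l" "real (q * a)"])
        (auto simp: algebra_simps)
  next
    case (many_\<alpha> u l)
    let ?m = "min (real l) (real N + real l - real b)"
    have "?m \<le> real (min l (N + l - b))"
      unfolding of_nat_min by (rule min.mono) auto
    then have "?m - real a \<le> real (min l (N + l - b) - a)" by linarith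
    from repetition[OF many_\<alpha>(6) this]
    have "(1 - d) * (?m - real a) \<le> real u + real a + J"
      by (simp add: algebra_simps)
    then show ?thesis
      using repetition[OF many_\<alpha>(4), of "N + a"] repetition[OF many_\<alpha>(5), of "real N + real l - real b"] many_\<alpha>(2)
        four[OF many_\<alpha>(1,3)]
      by (intro bound_many_\<alpha>[OF d J _ _ _ _ _ ret count[OF many_\<alpha>(1)], of "real l"])
        (auto simp: algebra_simps)
  next
    case (many_\<beta> u l q)
    have "(1 - d) * (real N + real l + real a + real b) \<le> real u + real a + real (q * b) + real b + J"
      using repetition[OF many_\<beta>(6), of "N + l + a + b"] by (simp add: algebra_simps)
    then show ?thesis
      using repetition[OF many_\<beta>(4), of "N + l"] repetition[OF many_\<beta>(5), of "N + q * b"] many_\<beta>(2)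
      by (intro bound_many_\<beta>[OF d J _ _ _ _ _ ret count[OF many_\<beta>(1)], of "real l" "real (q * b)"])
        (auto simp: algebra_simps)
  next
    case (four_returns u l)
    show ?thesis
      using repetition[OF four_returns(4), of "N"] repetition[OF four_returns(5), of "N + l"]
        repetition[OF four_returns(6), of "real N + real l - real b"] four_returns(2)
        four[OF four_returns(1,3)]
      by (intro bound_four_returns[OF d J _ _ _ _ _ ret count[OF four_returns(1)], of "real l"])
        (auto simp: algebra_simps)
  qed
qed

lemma (in bispecial_level) level_bound:
  fixes d J :: real
  assumes fin: "finite (range x)"
    and d: "0 \<le> d" "d \<le> 5/24"
    and rep: "\<And>n. (1 - d) * real n \<le> real (repetition n x) + J"
    and compl: "\<And>n. real (complexity n x) \<le> (4/3 - 8/5 * d) * real n + J - 2"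
  shows "d * real N \<le> 20 * J"
proof (cases "x (first + N) = \<alpha>")
  case False
  then have "x (first + N) = \<beta>" using occ_first letters by (auto simp: occ_def)
  then show ?thesis
    using bispecial_level.level_bound_\<alpha>[OF swap_bispecial fin _ d rep compl] by blast
qed (use level_bound_\<alpha>[OF fin _ d rep compl] in blast)

text \<open>Growth by at least two from \<open>n0\<close> on would exceed the slope 4/3, so there is
  a bispecial level beyond \<open>20 * J / d\<close>, against \<open>level_bound\<close>.\<close>

lemma repetition_complexity_incompatible:
  fixes d J :: real
  assumes fin: "finite (range x)" and np: "\<not> ultimately_periodic x"
    and d: "0 < d" "d \<le> 5/24"
    and rep: "\<And>n. (1 - d) * real n \<le> real (repetition n x) + J"
    and compl: "\<And>n. real (complexity n x) \<le> (4/3 - 8/5 * d) * real n + J - 2"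
  shows False
proof -
  obtain n0 :: nat where n0: "20 * J / d < real n0" using reals_Archimedean2 by blast
  have "\<exists>n\<ge>n0. complexity (Suc n) x \<le> complexity n x + 1"
  proof (rule ccontr)
    assume "\<not> ?thesis"
    then have "\<not> complexity (Suc n) x \<le> complexity n x + 1" if "n \<ge> n0" for n using that by blast
    then have steep: "complexity n x + 2 \<le> complexity (Suc n) x" if "n \<ge> n0" for n
      using that by fastforce
    have "2 * k \<le> complexity (n0 + k) x" for k
    proof (induction k)
      case (Suc k)
      then show ?case using steep[of "n0 + k"] by simp
    qed simp
    then have bound: "2 * real k \<le> 4/3 * (real n0 + real k) + J" for k
    proof -
      have "2 * real k \<le> real (complexity (n0 + k) x)"
        using \<open>2 * k \<le> complexity (n0 + k) x\<close> by linarith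
      also have "\<dots> \<le> (4/3 - 8/5 * d) * real (n0 + k) + J - 2" by (rule compl)
      also have "\<dots> \<le> 4/3 * real (n0 + k) + J"
        using mult_right_mono[of "4/3 - 8/5 * d" "4/3" "real (n0 + k)"] d by linarith
      finally show ?thesis by simp
    qed
    obtain k :: nat where "2 * real n0 + 3/2 * J < real k" using reals_Archimedean2 by blast
    then show False using bound[of k] by argo
  qed
  then obtain n where n: "n \<ge> n0" "complexity (Suc n) x \<le> complexity n x + 1" by blast
  obtain r' \<alpha> \<beta> a b where "special_level x n r' \<alpha> \<beta> a b"
    using ex_special_level[OF fin np n(2)] by blast
  from ex_bispecial_level[OF this] obtain N r
    where N: "N \<ge> n" "bispecial_level x N r \<alpha> \<beta> a b" by blast
  have "d * real N \<le> 20 * J"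
    using bispecial_level.level_bound[OF N(2) fin _ d(2) rep compl] d(1) by simp
  then have "real N \<le> 20 * J / d" using d(1) by (simp add: field_simps)
  then show False using n0 n(1) N(1) by linarith
qed

section \<open>Rational approximation from repetitions\<close>

locale digit_word =
  fixes b :: nat and x :: "nat \<Rightarrow> nat"
  assumes base: "b \<ge> 2" and digits: "range x \<subseteq> {0..<b}"
begin

text \<open>The remainder of the expansion after \<open>k\<close> digits, equal to
  \<open>b ^ k * tail 0\<close> up to an integer; the value 1 is allowed.\<close>

definition tail :: "nat \<Rightarrow> real" where
  "tail k = (\<Sum>j. real (x (k + j)) / real b ^ Suc j)"

lemma digit_le: "x j \<le> b - 1"
  using digits base by (auto simp: subset_iff) (metis Suc_pred atLeastLessThan_iff less_Suc_eq_le
    not_gr_zero not_less_zero rangeI)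

lemma max_digit_sums: "(\<lambda>j. real (b - 1) / real b ^ Suc j) sums 1"
proof -
  have "(\<lambda>j. real (b - 1) / real b * (1 / real b) ^ j) sums (real (b - 1) / real b * (1 / (1 - 1 / real b)))"
    using base by (intro sums_mult geometric_sums) auto
  moreover have "real (b - 1) / real b * (1 / (1 - 1 / real b)) = 1"
    using base by (simp add: field_simps of_nat_diff)
  moreover have "real (b - 1) / real b * (1 / real b) ^ j = real (b - 1) / real b ^ Suc j" for j
    by (simp add: power_one_over)
  ultimately show ?thesis by (simp only:)
qed

lemma summable_digits: "summable (\<lambda>j. real (x (k + j)) / real b ^ Suc j)"
proof (rule summable_comparison_test')
  show "norm (real (x (k + j)) / real b ^ Suc j) \<le> real (b - 1) / real b ^ Suc j" if "j \<ge> 0" for j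
    using digit_le[of "k + j"] by (simp add: divide_right_mono del: of_nat_diff)
qed (use max_digit_sums sums_summable in blast)

lemma tail_nonneg: "0 \<le> tail k"
  unfolding tail_def by (intro suminf_nonneg summable_digits) simp

lemma tail_le_1: "tail k \<le> 1"
  unfolding tail_def sums_unique[OF max_digit_sums] using digit_le
  by (intro suminf_le summable_digits sums_summable[OF max_digit_sums] divide_right_mono) auto

lemma tail_Suc: "real b * tail k = real (x k) + tail (Suc k)"
proof -
  have "tail k = real (x k) / real b + (\<Sum>j. real (x (k + Suc j)) / real b ^ Suc (Suc j))"
    unfolding tail_def using suminf_split_head[OF summable_digits[of k]] by simp
  also have "(\<Sum>j. real (x (k + Suc j)) / real b ^ Suc (Suc j)) = tail (Suc k) / real b"
    unfolding tail_def using suminf_divide[OF summable_digits[of "Suc k"], of "real b"] by (simp add: mult.commute)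
  finally show ?thesis using base by (simp add: field_simps)
qed

lemma tail_zero:
  assumes "tail k = 0" shows "x (k + j) = 0"
  using suminf_eq_zero_iff[OF summable_digits[of k]] assms base by (auto simp: tail_def)

lemma ex_prefix_value: "\<exists>c::int. real b ^ k * tail 0 = of_int c + tail k"
proof (induction k)
  case 0
  show ?case by (intro exI[of _ 0]) simp
next
  case (Suc k)
  then obtain c :: int where "real b ^ k * tail 0 = of_int c + tail k" by blast
  then have "real b ^ Suc k * tail 0 = real b * of_int c + real b * tail k"
    by (simp add: distrib_left mult.assoc)
  then have "real b ^ Suc k * tail 0 = of_int (int b * c + int (x k)) + tail (Suc k)"
    by (simp add: tail_Suc)
  then show ?case by blast
qed

lemma tail_diff_le:
  "agree x k m n \<Longrightarrow> \<bar>tail k - tail m\<bar> \<le> 1 / real b ^ n"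
proof (induction n arbitrary: k m)
  case 0
  then show ?case using tail_nonneg[of k] tail_nonneg[of m] tail_le_1[of k] tail_le_1[of m] by simp
next
  case (Suc n)
  then have "\<bar>tail (Suc k) - tail (Suc m)\<bar> \<le> 1 / real b ^ n" "x k = x m"
    by (simp_all add: agree_Suc_left)
  moreover have "tail (Suc k) - tail (Suc m) = real b * (tail k - tail m)"
    using \<open>x k = x m\<close> tail_Suc[of k] tail_Suc[of m] by (simp add: algebra_simps)
  then have "\<bar>tail k - tail m\<bar> = \<bar>tail (Suc k) - tail (Suc m)\<bar> / real b"
    using base by (simp add: abs_mult)
  ultimately show ?case
    using divide_right_mono[of "\<bar>tail (Suc k) - tail (Suc m)\<bar>" "1 / real b ^ n" "real b"]
    by (simp add: mult.commute)
qed

text \<open>For a rational value with denominator \<open>q\<close>, all \<open>q * tail k\<close>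
  are integers between 0 and \<open>q\<close>, so two tails coincide; equal tails have equal digits,
  and the word would be ultimately periodic.\<close>

lemma tail_irrational:
  assumes np: "\<not> ultimately_periodic x"
  shows "tail 0 \<notin> \<rat>"
proof
  assume "tail 0 \<in> \<rat>"
  then obtain p q :: int where q: "q > 0" "tail 0 = of_int p / of_int q"
    by (metis Rats_cases')
  have "of_int q * tail k \<in> of_int ` {0..q}" for k
  proof -
    obtain c :: int where c: "real b ^ k * tail 0 = of_int c + tail k" using ex_prefix_value by blast
    define z where "z = int b ^ k * p - q * c"
    have z: "of_int q * tail k = of_int z"
      using c q by (simp add: z_def field_simps)
    have "0 \<le> of_int q * tail k" "of_int q * tail k \<le> of_int q"
      using tail_nonneg[of k] tail_le_1[of k] q by auto
    then have "z \<in> {0..q}" unfolding z by simp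
    then show ?thesis using z by blast
  qed
  then have "range (\<lambda>k. of_int q * tail k) \<subseteq> of_int ` {0..q}" by blast
  then have "finite (range (\<lambda>k. of_int q * tail k))" by (rule finite_subset) simp
  then have "\<not> inj (\<lambda>k. of_int q * tail k)" using finite_imageD infinite_UNIV_nat by blast
  then obtain k m where km: "k < m" "tail k = tail m"
    using q by (auto simp: inj_on_def) (metis linorder_neqE_nat)
  have pos: "tail k > 0" for k
  proof (rule ccontr)
    assume "\<not> tail k > 0"
    then have "tail k = 0" using tail_nonneg[of k] by simp
    then have "x n = 0" if "n \<ge> k" for n using tail_zero[of k "n - k"] that by simp
    then have "ultimately_periodic x"
      unfolding ultimately_periodic_def by (intro exI[of _ k] exI[of _ 1]) auto
    then show False using np by simp
  qed
  have step: "x i = x j \<and> tail (Suc i) = tail (Suc j)" if "tail i = tail j" for i j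
  proof -
    have eq: "real (x i) + tail (Suc i) = real (x j) + tail (Suc j)"
      using tail_Suc[of i] tail_Suc[of j] that by simp
    \<comment> \<open>Tails are positive and at most 1, so they differ by less than 1 and cannot
      compensate different digits.\<close>
    have "x i = x j"
      using eq pos[of "Suc i"] pos[of "Suc j"] tail_le_1[of "Suc i"] tail_le_1[of "Suc j"] by linarith
    then show ?thesis using eq by simp
  qed
  have "tail (k + i) = tail (m + i)" for i
  proof (induction i)
    case (Suc i)
    then show ?case using step[of "k + i" "m + i"] by simp
  qed (use km in simp)
  then have eq: "x (m + i) = x (k + i)" for i using step[of "k + i" "m + i"] by simp
  have "x (n + (m - k)) = x n" if "n \<ge> k" for n
  proof -
    have "m + (n - k) = n + (m - k)" "k + (n - k) = n" using that km(1) by auto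
    then show ?thesis using eq[of "n - k"] by simp
  qed
  then have "ultimately_periodic x"
    unfolding ultimately_periodic_def using km(1) by (intro exI[of _ k] exI[of _ "m - k"]) auto
  then show False using np by simp
qed

text \<open>Multiplication by \<open>b ^ m - b ^ i\<close> turns \<open>tail 0\<close> into an
  integer plus \<open>tail m - tail i\<close>, which the agreement makes small.\<close>

lemma rational_approximation:
  assumes "i < m" "agree x i m n"
  obtains p :: int and q :: nat where "q \<ge> 1" "real q < real b ^ m"
    "\<bar>tail 0 - of_int p / of_nat q\<bar> \<le> 1 / (real q * real b ^ n)"
proof -
  obtain c :: int where c: "real b ^ i * tail 0 = of_int c + tail i" using ex_prefix_value by blast
  obtain c' :: int where c': "real b ^ m * tail 0 = of_int c' + tail m" using ex_prefix_value by blast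
  define q where "q = b ^ m - b ^ i"
  have lt: "b ^ i < b ^ m" using base assms(1) by (intro power_strict_increasing) auto
  then have q1: "q \<ge> 1" by (simp add: q_def)
  have q: "real q = real b ^ m - real b ^ i"
    using lt by (simp add: q_def of_nat_diff)
  then have "real q * tail 0 = real b ^ m * tail 0 - real b ^ i * tail 0"
    by (simp add: left_diff_distrib)
  then have "real q * tail 0 - of_int (c' - c) = tail m - tail i"
    unfolding c c' by simp
  then have "tail 0 - of_int (c' - c) / real q = (tail m - tail i) / real q"
    using q1 by (simp add: field_simps)
  then have "\<bar>tail 0 - of_int (c' - c) / real q\<bar> = \<bar>tail m - tail i\<bar> / real q" by simp
  also have "\<dots> \<le> (1 / real b ^ n) / real q"
    using tail_diff_le[OF agree_sym[OF assms(2)]] q1 by (intro divide_right_mono) auto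
  finally show ?thesis
    using that[of q "c' - c"] q1 q base by (simp add: mult.commute)
qed

lemma irrationality_exponent_ge:
  assumes np: "\<not> ultimately_periodic x" and \<mu>: "\<mu> > 1"
    and rep: "\<And>n0. \<exists>n\<ge>n0. (\<mu> - 1) * real (repetition n x) \<le> real n"
  shows "irrationality_exponent (tail 0) \<ge> ereal \<mu>"
proof -
  define S where "S = {s::rat. \<exists>(p::int) (q::nat). q \<ge> 1 \<and> s = of_int p / of_nat q \<and>
    \<bar>tail 0 - of_int p / of_nat q\<bar> < of_nat q powr (- \<mu>)}"
  have fin: "finite (range x)" using digits finite_subset by blast
  have approx: "\<exists>s\<in>S. \<bar>tail 0 - of_rat s\<bar> \<le> 1 / real b ^ n0" for n0
  proof -
    obtain n where n: "n \<ge> n0" "(\<mu> - 1) * real (repetition n x) \<le> real n" using rep by blast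
    let ?m = "repetition n x"
    obtain i where "i < ?m" "agree x i ?m n" using ex_agree_repetition[OF fin] by blast
    then obtain p :: int and q :: nat where q: "q \<ge> 1" "real q < real b ^ ?m"
      "\<bar>tail 0 - of_int p / of_nat q\<bar> \<le> 1 / (real q * real b ^ n)"
      by (rule rational_approximation)
    have "real q powr (\<mu> - 1) < (real b ^ ?m) powr (\<mu> - 1)"
      using q \<mu> by (intro powr_less_mono2) auto
    also have "\<dots> = real b powr ((\<mu> - 1) * real ?m)"
      using base by (simp add: powr_realpow[symmetric] powr_powr mult.commute)
    also have "\<dots> \<le> real b powr real n" using n base by (intro powr_mono) auto
    also have "\<dots> = real b ^ n" using base by (simp add: powr_realpow)
    finally have "1 / (real q * real b ^ n) < 1 / (real q * real q powr (\<mu> - 1))"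
      using q base by (intro divide_strict_left_mono mult_strict_left_mono mult_pos_pos) auto
    also have "\<dots> = real q powr (- \<mu>)"
      using q by (simp add: powr_diff powr_minus divide_simps)
    finally have "of_int p / of_nat q \<in> S" unfolding S_def using q by fastforce
    moreover have "1 / (real q * real b ^ n) \<le> 1 / real b ^ n0"
    proof -
      have "real b ^ n0 \<le> real b ^ n" using n base by (intro power_increasing) auto
      also have "\<dots> \<le> real q * real b ^ n" using q base by simp
      finally show ?thesis using base q by (intro divide_left_mono mult_pos_pos) auto
    qed
    ultimately show ?thesis
      using q by (intro bexI[of _ "of_int p / of_nat q"]) (auto simp: of_rat_divide)
  qed
  \<comment> \<open>Different \<open>n\<close> may give the same rational. But finitely many
    rationals stay at a positive distance from an irrational number, while the approximations come
    arbitrarily close.\<close>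
  have "infinite S"
  proof
    assume "finite S"
    define \<epsilon> where "\<epsilon> = Min ((\<lambda>s. \<bar>tail 0 - of_rat s\<bar>) ` S)"
    have "S \<noteq> {}" using approx by blast
    then have "\<epsilon> \<in> (\<lambda>s. \<bar>tail 0 - of_rat s\<bar>) ` S"
      unfolding \<epsilon>_def using \<open>finite S\<close> by (intro Min_in) auto
    moreover have "tail 0 \<noteq> of_rat s" for s using tail_irrational[OF np] by auto
    ultimately have "\<epsilon> > 0" by auto
    then obtain n where "(1 / real b) ^ n < \<epsilon>"
      using real_arch_pow_inv[of \<epsilon> "1 / real b"] base by auto
    moreover obtain s where "s \<in> S" "\<bar>tail 0 - of_rat s\<bar> \<le> 1 / real b ^ n" using approx by blast
    moreover have "\<epsilon> \<le> \<bar>tail 0 - of_rat s\<bar>" if "s \<in> S" for s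
      unfolding \<epsilon>_def using that \<open>finite S\<close> by (intro Min_le) auto
    ultimately show False by (fastforce simp: power_one_over)
  qed
  then show ?thesis
    unfolding irrationality_exponent_def S_def by (intro SUP_upper) simp
qed

end

section \<open>The bounds for words of low complexity\<close>

lemma liminf_repetition_le:
  fixes \<rho> d :: real
  assumes fin: "finite (range x)" and np: "\<not> ultimately_periodic x"
    and limsup: "limsup (\<lambda>n. ereal (real (complexity n x) / real n)) = ereal \<rho>"
    and d: "0 < d" "d \<le> 5/24" "\<rho> < 4/3 - 8/5 * d"
  shows "liminf (\<lambda>n. ereal (real (repetition n x) / real n)) \<le> ereal (1 - d)"
proof (rule ccontr)
  assume "\<not> ?thesis"
  then have "ereal (1 - d) < liminf (\<lambda>n. ereal (real (repetition n x) / real n))" by simp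
  then have "\<forall>\<^sub>F n in sequentially. ereal (1 - d) < ereal (real (repetition n x) / real n)"
    by (rule less_LiminfD)
  moreover have "\<forall>\<^sub>F n in sequentially. ereal (real (complexity n x) / real n) < ereal (4/3 - 8/5 * d)"
    by (rule Limsup_lessD) (use limsup d in simp)
  ultimately have "\<forall>\<^sub>F n in sequentially. (1 - d) * real n \<le> real (repetition n x) \<and>
      real (complexity n x) \<le> (4/3 - 8/5 * d) * real n"
    using eventually_gt_at_top[of 0] by eventually_elim (simp add: field_simps)
  then obtain n0 where n0: "(1 - d) * real n \<le> real (repetition n x)"
    "real (complexity n x) \<le> (4/3 - 8/5 * d) * real n" if "n \<ge> n0" for n
    by (auto simp: eventually_sequentially)
  \<comment> \<open>The summand \<open>n0\<close> serves the repetition bound below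
    \<open>n0\<close>, the sum the complexity bound there, and 2 offsets the
    \<open>- 2\<close>.\<close>
  define J where "J = real n0 + real (\<Sum>n<n0. complexity n x) + 2"
  have "(1 - d) * real n \<le> real (repetition n x) + J" for n
  proof (cases "n \<ge> n0")
    case False
    have "(1 - d) * real n \<le> real n" using d by (simp add: mult_left_le_one_le)
    moreover have "0 \<le> real (\<Sum>n<n0. complexity n x)" by (rule of_nat_0_le_iff)
    moreover have "real n \<le> real n0" using False by simp
    ultimately show ?thesis unfolding J_def by linarith
  next
    case True
    have "0 \<le> J" by (simp add: J_def sum_nonneg)
    then show ?thesis using n0(1)[OF True] by linarith
  qed
  moreover have "real (complexity n x) \<le> (4/3 - 8/5 * d) * real n + J - 2" for n
  proof (cases "n \<ge> n0")
    case False
    then have "complexity n x \<le> (\<Sum>n<n0. complexity n x)" by (intro member_le_sum) auto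
    then have "real (complexity n x) \<le> J - 2" by (simp add: J_def del: of_nat_sum)
    moreover have "0 \<le> (4/3 - 8/5 * d) * real n" using d by simp
    ultimately show ?thesis by linarith
  next
    case True
    have "0 \<le> J - 2" by (simp add: J_def sum_nonneg)
    then show ?thesis using n0(2)[OF True] by linarith
  qed
  ultimately show False
    using repetition_complexity_incompatible[OF fin np d(1,2)] by blast
qed

theorem theorem1p4:
  fixes b :: nat and x :: "nat \<Rightarrow> nat" and \<rho> :: real
  assumes "b \<ge> 2"
    and "range x \<subseteq> {0..<b}"
    and "\<not> ultimately_periodic x"
    and "limsup (\<lambda>n. ereal (real (complexity n x) / real n)) = ereal \<rho>"
    and "\<rho> < 4 / 3"
  shows "liminf (\<lambda>n. ereal (real (repetition n x) / real n))
           \<le> ereal (1 - (4 - 3 * \<rho>) / (2 * (1 + 2 * \<rho>) * (2 - \<rho>)))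
       \<and> irrationality_exponent (\<Sum>j. real (x j) / real b ^ Suc j)
           \<ge> ereal (2 + (4 - 3 * \<rho>) / (\<rho> * (9 - 4 * \<rho>)))"
proof
  interpret digit_word b x by unfold_locales (use assms in auto)
  have fin: "finite (range x)" using assms(2) finite_subset by blast
  have "1 \<le> limsup (\<lambda>n. ereal (real (complexity n x) / real n))"
  proof (rule le_Limsup)
    have "1 \<le> ereal (real (complexity n x) / real n)" if "n > 0" for n
      using complexity_ge[OF fin assms(3), of n] that by (simp add: one_ereal_def)
    then show "\<forall>\<^sub>F n in sequentially. 1 \<le> ereal (real (complexity n x) / real n)"
      using eventually_gt_at_top[of 0] by (rule eventually_mono[rotated])
  qed simp
  then have \<rho>: "1 \<le> \<rho>" using assms(4) by (simp add: one_ereal_def)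
  define D where "D = 2 * (1 + 2 * \<rho>) * (2 - \<rho>)"
  define d where "d = (4 - 3 * \<rho>) / D"
  \<comment> \<open>The chord of \<rho>^2 over the interval from 1 to 4/3 gives D at least 28/3 -
    10/3 \<rho>, which exceeds 44/9.\<close>
  have D: "D > 24/5"
  proof -
    have "0 \<le> (\<rho> - 1) * (4/3 - \<rho>)" using \<rho> assms(5) by (intro mult_nonneg_nonneg) auto
    moreover have "(\<rho> - 1) * (4/3 - \<rho>) = 7/3 * \<rho> - 4/3 - \<rho> * \<rho>" by (simp add: field_simps)
    moreover have "D = 4 + 6 * \<rho> - 4 * (\<rho> * \<rho>)" by (simp add: D_def algebra_simps)
    ultimately show ?thesis using assms(5) by linarith
  qed
  have d0: "0 < d" using D assms(5) by (simp add: d_def)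
  \<comment> \<open>This leads to \<open>\<rho> < 4/3 - 8/5 * d\<close>, and with
    \<open>1 \<le> \<rho>\<close> also to \<open>d \<le> 5/24\<close>.\<close>
  have "4 - 3 * \<rho> < 5/24 * (4 - 3 * \<rho>) * D"
    using mult_strict_left_mono[OF D, of "5/24 * (4 - 3 * \<rho>)"] assms(5) by simp
  then have "d < 5/24 * (4 - 3 * \<rho>)"
    unfolding d_def using D by (subst pos_divide_less_eq) auto
  then have d_less: "d < 5/6 - 5/8 * \<rho>" by (simp add: field_simps)
  show le: "liminf (\<lambda>n. ereal (real (repetition n x) / real n))
      \<le> ereal (1 - (4 - 3 * \<rho>) / (2 * (1 + 2 * \<rho>) * (2 - \<rho>)))"
  proof -
    have "d \<le> 5/24" using d_less \<rho> by linarith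
    moreover have "\<rho> < 4/3 - 8/5 * d" using d_less by linarith
    ultimately show ?thesis
      using liminf_repetition_le[OF fin assms(3,4) d0] unfolding d_def D_def by blast
  qed
  define \<mu> where "\<mu> = 2 + (4 - 3 * \<rho>) / (\<rho> * (9 - 4 * \<rho>))"
  have d1: "d < 1" using d_less \<rho> by linarith
  have Dd: "4 - 3 * \<rho> = D * d" using D by (simp add: d_def)
  \<comment> \<open>The denominator is \<open>D * (1 - d)\<close>, so the claimed exponent is 1 +
    1/(1 - d).\<close>
  have "\<rho> * (9 - 4 * \<rho>) = D - (4 - 3 * \<rho>)" by (simp add: D_def algebra_simps)
  then have "\<rho> * (9 - 4 * \<rho>) = D * (1 - d)" by (simp add: Dd right_diff_distrib)
  then have "\<mu> - 1 = 1 + d / (1 - d)" using D by (simp add: \<mu>_def Dd)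
  then have \<mu>: "\<mu> - 1 = 1 / (1 - d)" using d1 by (simp add: field_simps)
  then have gt1: "\<mu> > 1" using d1 by (smt (verit) zero_less_divide_1_iff)
  show "irrationality_exponent (\<Sum>j. real (x j) / real b ^ Suc j) \<ge> ereal \<mu>"
  proof (rule ccontr)
    let ?E = "irrationality_exponent (tail 0)"
    assume "\<not> ?thesis"
    then have "?E < ereal \<mu>" by (simp add: tail_def)
    then have "max ?E 1 < ereal \<mu>" using gt1 by (simp add: one_ereal_def)
    \<comment> \<open>As \<open>le\<close> is not strict, r(n) may exceed (1 - d) n for all n; an
      exponent \<open>z\<close> below \<mu> leaves the necessary room.\<close>
    then obtain z where z: "max ?E 1 < ereal z" "ereal z < ereal \<mu>" using ereal_dense2 by blast
    then have z1: "1 < z" "z < \<mu>" by (auto simp: one_ereal_def)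
    have "1 - d < 1 / (z - 1)"
    proof -
      have "z - 1 < 1 / (1 - d)" using \<mu> z1 by linarith
      then show ?thesis using z1 d1 by (simp add: field_simps)
    qed
    have "\<exists>n\<ge>n0. (z - 1) * real (repetition n x) \<le> real n" for n0
    proof (rule ccontr)
      assume none: "\<not> ?thesis"
      have "ereal (1 / (z - 1)) \<le> liminf (\<lambda>n. ereal (real (repetition n x) / real n))"
      proof (rule Liminf_bounded)
        have "1 / (z - 1) \<le> real (repetition n x) / real n" if "n \<ge> Suc n0" for n
        proof -
          have "\<not> (z - 1) * real (repetition n x) \<le> real n" using none that Suc_leD by blast
          then have "real n < (z - 1) * real (repetition n x)" by simp
          then show ?thesis using that z1 by (simp add: divide_le_eq le_divide_eq mult.commute)
        qed
        then show "\<forall>\<^sub>F n in sequentially. ereal (1 / (z - 1)) \<le> ereal (real (repetition n x) / real n)"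
          by (auto simp: eventually_sequentially)
      qed
      also have "\<dots> \<le> ereal (1 - d)" using le by (simp add: d_def D_def)
      finally show False using \<open>1 - d < 1 / (z - 1)\<close> by simp
    qed
    then have "ereal z \<le> ?E" by (rule irrationality_exponent_ge[OF assms(3) z1(1)])
    moreover have "?E < ereal z" using z by simp
    ultimately show False by simp
  qed
qed

end
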